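(* Let $A,B$ be positive integers such that $A$ is prime to $p$ and $A$, $B$ and $A+B$ are all FM-exponents for $p$. Then $(A,B)$ or $(B,A)$ is one of the following pairs: (1) $\big(\frac{p^a+1}{p^b+1},\,p^b\frac{p^a+1}{p^b+1}\big)$ with $b\ge1$ and $a\ge b$ an odd multiple of $b$; (2) $\big(\frac{p^{a+2b}+1}{p^b+1},\,p^b\frac{p^a+1}{p^b+1}\big)$ with $b\ge1$ and $a\ge b$ an odd multiple of $b$; (3) $p\ge3$: $\big(\frac{p^a+1}{2},\frac{p^a+1}{2}\big)$, $a\ge0$; (4) $p=2$: $(3,10),(5,6),(5,8),(5,17),(5,52),(9,2),(9,4),(9,11),(9,13),(9,17),(9,34),(9,43),(9,48),(11,2),(11,13),(11,57),(13,44),(13,228),(17,26),(17,40),(33,10),(33,24),(33,172),(33,208),(65,176),(171,34),(205,36)$; (5) $p=2$: $(2^a+1,2^a+1)$, $a\ge1$; (6) $p=2$: $\big(\frac{2^a+1}{2^b+1},\frac{2^a+1}{2^b+1}\big)$, $b\ge1$, $a$ an odd multiple of $b$; (7) $p=2$: $(1,2^a+1)$, $a\ge1$; (8) $p=2$: $(2^a+1,2^a)$, $a\ge1$; (9) $p=2$: $(3,2^a+1)$, $a\ge1$; (10) $p=2$: $(2^a+1,3\cdot2^a)$, $a\ge1$; (11) $p=2$: $\big(2^a+1,\frac{2^{3a}+1}{2^a+1}\big)$, $a\ge1$; (12) $p=2$: $\big(\frac{2^{3a}+1}{2^a+1},2^a(2^a+1)\big)$, $a\ge1$; (13) $p=2$: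 $\big(2^a+1,\frac{2^a+1}{3}\big)$, $a\ge1$ odd; (14) $p=2$: $\big(1,\frac{2^a+1}{3}\big)$, $a\ge1$ odd; (15) $p=2$: $\big(\frac{2^a+1}{3},2^a\big)$, $a\ge1$ odd; (16) $p=2$: $\big(3,\frac{2^{2a}+1}{5}\big)$, $a\ge1$ odd; (17) $p=2$: $\big(\frac{2^{2a}+1}{5},3\cdot2^{2a}\big)$, $a\ge1$ odd; (18) $p=2$: $\big(5,\frac{2^a+1}{3}\big)$, $a\ge1$ odd; (19) $p=2$: $\big(\frac{2^a+1}{3},5\cdot2^a\big)$, $a\ge1$ odd; (20) $p=2$: $\big(\frac{2^{3a}+1}{9},\frac{2^{3a}+1}{3}\big)$, $a\ge1$ odd; (21) $p=2$: $\big(\frac{2^{3a}+1}{9},2\cdot\frac{2^{3a}+1}{9}\big)$, $a\ge1$ odd; (22) $p=3$: $(2,5),(4,3),(4,10),(5,7),(10,63),(28,45),(61,12)$; (23) $p=3$: $(2,3^a+1)$, $a\ge0$; (24) $p=3$: $(3^a+1,2\cdot3^a)$, $a\ge0$; (25) $p=3$: $\big(3^a+1,\frac{3^a+1}{2}\big)$, $a\ge0$; (26) $p=3$: $\big(1,\frac{3^a+1}{2}\big)$, $a\ge0$; (27) $p=3$: $\big(\frac{3^a+1}{2},3^a\big)$, $a\ge0$; (28) $p=3$: $\big(4,\frac{3^a+1}{2}\big)$, $a\ge0$; (29) $p=3$: $\big(\frac{3^a+1}{2},4\cdot3^a\big)$, $a\ge0$; (30) $p=3$: $\big(\frac{3^a+1}{2},\frac{3^a+1}{4}\big)$,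 $a\ge1$ odd; (31) $p=3$: $\big(\frac{3^a+1}{4},\frac{3^a+1}{4}\big)$, $a\ge1$ odd; (32) $p=3$: $\big(2,\frac{3^a+1}{4}\big)$, $a\ge1$ odd; (33) $p=3$: $\big(\frac{3^a+1}{4},2\cdot3^a\big)$, $a\ge1$ odd; (34) $p=5$: $(1,6),(2,5),(3,7),(6,7),(6,15)$; (35) $p=5$: $\big(2,\frac{5^a+1}{2}\big)$, $a\ge0$; (36) $p=5$: $\big(\frac{5^a+1}{2},2\cdot5^a\big)$, $a\ge0$; (37) $p=7$: $(2,2)$.
   Context: $p$ is a prime. For a positive integer $n$, $n_{\hat p}$ is its prime-to-$p$ part. A positive integer $d$ is an FM-exponent for $p$ if $d_{\hat p}$ is of one of the forms: (i) $p^a+1$ with $a\ge0$ ($a>0$ if $p=2$); (ii) $p>2$ and $\frac{p^a+1}{2}$ with $a>0$; (iii) $\frac{p^{ab}+1}{p^a+1}$ with $a,b>0$ and $b$ odd (including $1$); (iv) $p=5$ and $d_{\hat p}=7$. *)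

theory Defs
  imports "HOL-Computational_Algebra.Primes"
begin

definition prime_to_part :: "nat \<Rightarrow> nat \<Rightarrow> nat" where
  "prime_to_part p n = n div p ^ multiplicity p n"

definition FM_exponent :: "nat \<Rightarrow> nat \<Rightarrow> bool" where
  "FM_exponent p d \<longleftrightarrow> d > 0 \<and>
     (let m = prime_to_part p d in
        (\<exists>a. m = p ^ a + 1 \<and> (p = 2 \<longrightarrow> a > 0))
      \<or> (p > 2 \<and> (\<exists>a>0. m = (p ^ a + 1) div 2))
      \<or> (\<exists>a b. a > 0 \<and> b > 0 \<and> odd b \<and> m = (p ^ (a * b) + 1) div (p ^ a + 1))
      \<or> (p = 5 \<and> m = 7))"

definition odd_multiple :: "nat \<Rightarrow> nat \<Rightarrow> bool" where
  "odd_multiple a b \<longleftrightarrow> a \<ge> b \<and> (\<exists>k. odd k \<and> a = k * b)"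

definition listed_pair :: "nat \<Rightarrow> nat \<Rightarrow> nat \<Rightarrow> bool" where
  "listed_pair p A B \<longleftrightarrow>
    \<comment> \<open>(1)\<close>
    (\<exists>a b. b \<ge> 1 \<and> odd_multiple a b \<and>
        A = (p^a + 1) div (p^b + 1) \<and> B = p^b * ((p^a + 1) div (p^b + 1)))
    \<comment> \<open>(2)\<close>
  \<or> (\<exists>a b. b \<ge> 1 \<and> odd_multiple a b \<and>
        A = (p^(a + 2*b) + 1) div (p^b + 1) \<and> B = p^b * ((p^a + 1) div (p^b + 1)))
    \<comment> \<open>(3)\<close>
  \<or> (p \<ge> 3 \<and> (\<exists>a. A = (p^a + 1) div 2 \<and> B = (p^a + 1) div 2))
    \<comment> \<open>(4)\<close>
  \<or> (p = 2 \<and> (A, B) \<in> {(3,10),(5,6),(5,8),(5,17),(5,52),(9,2),(9,4),(9,11),(9,13),(9,17),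
        (9,34),(9,43),(9,48),(11,2),(11,13),(11,57),(13,44),(13,228),(17,26),(17,40),(33,10),
        (33,24),(33,172),(33,208),(65,176),(171,34),(205,36)})
    \<comment> \<open>(5)\<close>
  \<or> (p = 2 \<and> (\<exists>a\<ge>1. A = 2^a + 1 \<and> B = 2^a + 1))
    \<comment> \<open>(6)\<close>
  \<or> (p = 2 \<and> (\<exists>a b. b \<ge> 1 \<and> (\<exists>k. odd k \<and> a = k * b) \<and>
        A = (2^a + 1) div (2^b + 1) \<and> B = (2^a + 1) div (2^b + 1)))
    \<comment> \<open>(7)\<close>
  \<or> (p = 2 \<and> (\<exists>a\<ge>1. A = 1 \<and> B = 2^a + 1))
    \<comment> \<open>(8)\<close>
  \<or> (p = 2 \<and> (\<exists>a\<ge>1. A = 2^a + 1 \<and> B = 2^a))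
    \<comment> \<open>(9)\<close>
  \<or> (p = 2 \<and> (\<exists>a\<ge>1. A = 3 \<and> B = 2^a + 1))
    \<comment> \<open>(10)\<close>
  \<or> (p = 2 \<and> (\<exists>a\<ge>1. A = 2^a + 1 \<and> B = 3 * 2^a))
    \<comment> \<open>(11)\<close>
  \<or> (p = 2 \<and> (\<exists>a\<ge>1. A = 2^a + 1 \<and> B = (2^(3*a) + 1) div (2^a + 1)))
    \<comment> \<open>(12)\<close>
  \<or> (p = 2 \<and> (\<exists>a\<ge>1. A = (2^(3*a) + 1) div (2^a + 1) \<and> B = 2^a * (2^a + 1)))
    \<comment> \<open>(13)\<close>
  \<or> (p = 2 \<and> (\<exists>a\<ge>1. odd a \<and> A = 2^a + 1 \<and> B = (2^a + 1) div 3))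
    \<comment> \<open>(14)\<close>
  \<or> (p = 2 \<and> (\<exists>a\<ge>1. odd a \<and> A = 1 \<and> B = (2^a + 1) div 3))
    \<comment> \<open>(15)\<close>
  \<or> (p = 2 \<and> (\<exists>a\<ge>1. odd a \<and> A = (2^a + 1) div 3 \<and> B = 2^a))
    \<comment> \<open>(16)\<close>
  \<or> (p = 2 \<and> (\<exists>a\<ge>1. odd a \<and> A = 3 \<and> B = (2^(2*a) + 1) div 5))
    \<comment> \<open>(17)\<close>
  \<or> (p = 2 \<and> (\<exists>a\<ge>1. odd a \<and> A = (2^(2*a) + 1) div 5 \<and> B = 3 * 2^(2*a)))
    \<comment> \<open>(18)\<close>
  \<or> (p = 2 \<and> (\<exists>a\<ge>1. odd a \<and> A = 5 \<and> B = (2^a + 1) div 3))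
    \<comment> \<open>(19)\<close>
  \<or> (p = 2 \<and> (\<exists>a\<ge>1. odd a \<and> A = (2^a + 1) div 3 \<and> B = 5 * 2^a))
    \<comment> \<open>(20)\<close>
  \<or> (p = 2 \<and> (\<exists>a\<ge>1. odd a \<and> A = (2^(3*a) + 1) div 9 \<and> B = (2^(3*a) + 1) div 3))
    \<comment> \<open>(21)\<close>
  \<or> (p = 2 \<and> (\<exists>a\<ge>1. odd a \<and> A = (2^(3*a) + 1) div 9 \<and> B = 2 * ((2^(3*a) + 1) div 9)))
    \<comment> \<open>(22)\<close>
  \<or> (p = 3 \<and> (A, B) \<in> {(2,5),(4,3),(4,10),(5,7),(10,63),(28,45),(61,12)})
    \<comment> \<open>(23)\<close>
  \<or> (p = 3 \<and> (\<exists>a. A = 2 \<and> B = 3^a + 1))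
    \<comment> \<open>(24)\<close>
  \<or> (p = 3 \<and> (\<exists>a. A = 3^a + 1 \<and> B = 2 * 3^a))
    \<comment> \<open>(25)\<close>
  \<or> (p = 3 \<and> (\<exists>a. A = 3^a + 1 \<and> B = (3^a + 1) div 2))
    \<comment> \<open>(26)\<close>
  \<or> (p = 3 \<and> (\<exists>a. A = 1 \<and> B = (3^a + 1) div 2))
    \<comment> \<open>(27)\<close>
  \<or> (p = 3 \<and> (\<exists>a. A = (3^a + 1) div 2 \<and> B = 3^a))
    \<comment> \<open>(28)\<close>
  \<or> (p = 3 \<and> (\<exists>a. A = 4 \<and> B = (3^a + 1) div 2))
    \<comment> \<open>(29)\<close>
  \<or> (p = 3 \<and> (\<exists>a. A = (3^a + 1) div 2 \<and> B = 4 * 3^a))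
    \<comment> \<open>(30)\<close>
  \<or> (p = 3 \<and> (\<exists>a\<ge>1. odd a \<and> A = (3^a + 1) div 2 \<and> B = (3^a + 1) div 4))
    \<comment> \<open>(31)\<close>
  \<or> (p = 3 \<and> (\<exists>a\<ge>1. odd a \<and> A = (3^a + 1) div 4 \<and> B = (3^a + 1) div 4))
    \<comment> \<open>(32)\<close>
  \<or> (p = 3 \<and> (\<exists>a\<ge>1. odd a \<and> A = 2 \<and> B = (3^a + 1) div 4))
    \<comment> \<open>(33)\<close>
  \<or> (p = 3 \<and> (\<exists>a\<ge>1. odd a \<and> A = (3^a + 1) div 4 \<and> B = 2 * 3^a))
    \<comment> \<open>(34)\<close>
  \<or> (p = 5 \<and> (A, B) \<in> {(1,6),(2,5),(3,7),(6,7),(6,15)})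
    \<comment> \<open>(35)\<close>
  \<or> (p = 5 \<and> (\<exists>a. A = 2 \<and> B = (5^a + 1) div 2))
    \<comment> \<open>(36)\<close>
  \<or> (p = 5 \<and> (\<exists>a. A = (5^a + 1) div 2 \<and> B = 2 * 5^a))
    \<comment> \<open>(37)\<close>
  \<or> (p = 7 \<and> A = 2 \<and> B = 2)"

end

theory Submission
  imports Defs
begin

text \<open>
  Multiplying out the denominators turns each case of \<open>A + p^k B = C\<close> or \<open>A + B = p^k C\<close> into the
  vanishing of a polynomial with integer coefficients at powers of \<open>p\<close> with unknown exponents.
  Such an equation is solved by \<open>p\<close>-adic descent: after removing the common factor, either the
  equation is contradictory (by sign, modulo \<open>p - 1\<close>, or because only the constant term is prime
  to \<open>p\<close>), or one branches on whether some exponent is zero, or on which of two exponents is larger,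
  reparametrising each branch by natural numbers again. The branching stops after finitely many
  steps with affine families of exponents, and these are the listed pairs.
\<close>

section \<open>A solver for exponential equations\<close>

text \<open>Since \<open>p\<close> does not divide \<open>A\<close>, it divides at most one of
  \<open>B\<close> and \<open>A + B\<close>, whence the two equations. The obstacle is form (iii):
  its exponent \<open>a * b\<close> is a product of unknowns, while the descent needs exponents
  affine in the unknowns. Relaxing this product to a free variable enlarges the solution set, so the
  tables may hold more than the true solutions. It suffices that every solution lies in a table and
  that a table entry which does satisfy form (iii) is listed. The bound 11 comes from the test
  modulo \<open>p - 1\<close>. At \<open>p = 1\<close> the cleared polynomial has the value 2(D2 D3
  + D1 D3 - D1 D2), where D1, D2, D3 belong to \<open>A\<close>, \<open>B\<close>, \<open>C\<close>
  and are 1 for p^a + 1 and 2 for the quotients (ii) and (iii). For odd \<open>p\<close>, the value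
  7 at \<open>p = 5\<close> aside, this is 0, 2, 6 or 8. If \<open>p >= 11\<close>, then
  \<open>p - 1\<close> divides only the 0, which leaves D1 = D2 = 2 and D3 = 1. For
  \<open>p = 7\<close> the value 6 survives too and yields the pair (2, 2); for smaller
  \<open>p\<close> the test excludes less or nothing, whence the long lists.\<close>

text \<open>The first exponent of a monomial is the exponent of \<open>p\<close> itself. The parameter \<open>b\<close> of the solver is
  either \<open>p\<close>, or \<open>0\<close> for an unspecified \<open>p \<ge> 11\<close>, in which case powers of \<open>p\<close> are kept symbolic.\<close>

type_synonym mpoly = "(int \<times> nat list) list"

text \<open>The fuel is there because 0 is divisible by \<open>b\<close> for ever. Moving factors of
  \<open>p\<close> from coefficients into slot 0 exposes them to \<open>common\<close> and to the
  test modulo \<open>p\<close> in \<open>contradictory\<close>.\<close>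

fun pull :: "nat \<Rightarrow> int \<Rightarrow> int \<Rightarrow> nat list \<Rightarrow> int \<times> nat list" where
  "pull (Suc f) b c (e # es) = (if c mod b = 0 then pull f b (c div b) (Suc e # es) else (c, e # es))"
| "pull f b c es = (c, es)"

fun mulpow :: "int \<Rightarrow> nat \<Rightarrow> int \<Rightarrow> int" where
  "mulpow b 0 c = c"
| "mulpow b (Suc e) c = mulpow b e (b * c)"

text \<open>Undoes \<open>pull\<close>: with a known prime, terms that differ only by a power of
  \<open>p\<close> must be recognised as like terms. For a symbolic prime slot 0 is treated like any
  other exponent.\<close>

fun collapse :: "int \<Rightarrow> int \<Rightarrow> nat list \<Rightarrow> int \<times> nat list" where
  "collapse b c (e # es) = (if b = 0 then (c, e # es) else (mulpow b e c, 0 # es))"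
| "collapse b c [] = (c, [])"

fun insert_term :: "int \<Rightarrow> nat list \<Rightarrow> mpoly \<Rightarrow> mpoly" where
  "insert_term c es [] = [(c, es)]"
| "insert_term c es ((d, fs) # F) = (if es = fs then (c + d, fs) # F else (d, fs) # insert_term c es F)"

fun collect :: "int \<Rightarrow> mpoly \<Rightarrow> mpoly \<Rightarrow> mpoly" where
  "collect b [] G = G"
| "collect b ((c, es) # F) G = (case collapse b c es of (c', es') \<Rightarrow> collect b F (insert_term c' es' G))"

text \<open>While solving, like terms can arise only when an exponent is set to 0:
  \<open>shift\<close> acts injectively on exponent vectors, so it keeps distinct monomials
  distinct.\<close>

definition merge :: "int \<Rightarrow> mpoly \<Rightarrow> mpoly" where
  "merge b F = filter (\<lambda>(c, es). c \<noteq> 0) (collect b F [])"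

fun common :: "mpoly \<Rightarrow> nat list" where
  "common [] = []"
| "common [(c, es)] = es"
| "common ((c, es) # F) = map2 min es (common F)"

definition strip :: "int \<Rightarrow> mpoly \<Rightarrow> mpoly" where
  "strip b F = (let G = (if b = 0 then F else map (\<lambda>(c, es). pull 64 b c es) F); m = common G
     in map (\<lambda>(c, es). (c, map2 (-) es m)) G)"

text \<open>The substitution of \<open>x i + x j\<close> for \<open>x i\<close>, read off on
  exponents. Slot 0 carries the value 1, so \<open>j = 0\<close> replaces \<open>x i\<close> by
  \<open>x i + 1\<close>.\<close>

definition shift :: "nat \<Rightarrow> nat \<Rightarrow> nat list \<Rightarrow> nat list" where
  "shift i j es = es[j := es ! j + es ! i]"

text \<open>A nonempty sum of terms of one sign is not zero; every power of \<open>p\<close> is 1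
  modulo \<open>p - 1\<close>; terms with positive slot 0 vanish modulo \<open>p\<close>. For a
  symbolic prime, the bounds 10 and 11 express that a nonzero integer below \<open>p - 1\<close> or
  \<open>p\<close> in absolute value is not a multiple of it.\<close>

definition contradictory :: "int \<Rightarrow> mpoly \<Rightarrow> bool" where
  "contradictory b F \<longleftrightarrow> list_all (\<lambda>(c, es). c > 0) F \<or> list_all (\<lambda>(c, es). c < 0) F
   \<or> (let s = sum_list (map fst F) in if b = 0 then s \<noteq> 0 \<and> \<bar>s\<bar> < 10 else s mod (b - 1) \<noteq> 0)
   \<or> (case filter (\<lambda>(c, es). hd es = 0) F of [t] \<Rightarrow>
        list_all (\<lambda>e. e = 0) (snd t) \<and>
        (if b = 0 then fst t \<noteq> 0 \<and> \<bar>fst t\<bar> < 11 else fst t mod b \<noteq> 0)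
      | _ \<Rightarrow> False)"

fun argmin :: "('a \<times> nat) \<Rightarrow> ('a \<times> nat) list \<Rightarrow> 'a" where
  "argmin (x, k) [] = x"
| "argmin (x, k) ((y, l) # ys) = (if l < k then argmin (y, l) ys else argmin (x, k) ys)"

text \<open>The pivots aim at a term that divides all others, since stripping it leaves a constant.
  The term of lowest degree is the candidate; comparing an exponent where it exceeds a rival with
  one where the rival exceeds it works towards divisibility. Once a constant exists, making
  exponents of the other terms positive pushes these terms into the multiples of
  \<open>p\<close>.\<close>

definition least :: "nat list list \<Rightarrow> nat list" where
  "least ts = (case map (\<lambda>t. (t, sum_list t)) ts of [] \<Rightarrow> [] | x # xs \<Rightarrow> argmin x xs)"

text \<open>The calls start with \<open>n = 1\<close> because their lists come without slot 0. The
  default 0 is returned when no entry is positive; as a first component of the pivot it stops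
  \<open>solve\<close>.\<close>

fun argmax :: "nat \<Rightarrow> nat \<Rightarrow> nat \<Rightarrow> nat list \<Rightarrow> nat" where
  "argmax i k n [] = i"
| "argmax i k n (x # xs) = (if k < x then argmax n x (Suc n) xs else argmax i k (Suc n) xs)"

text \<open>\<open>(i, 0)\<close> proposes to branch on whether exponent \<open>i\<close> vanishes, \<open>(i, j)\<close> to compare exponents \<open>i\<close> and \<open>j\<close>.\<close>

definition pivot :: "mpoly \<Rightarrow> nat \<times> nat" where
  "pivot F = (let T = map (tl \<circ> snd) F in
     if list_ex (list_all (\<lambda>e. e = 0)) T
     then (argmax 0 0 1 (least (filter (list_ex (\<lambda>e. e \<noteq> 0)) (map (tl \<circ> snd) (filter (\<lambda>(c, es). hd es = 0) F)))), 0)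
     else let u = least T; v = least (filter (\<lambda>t. list_ex (\<lambda>(x, y). y < x) (zip u t)) T)
       in (argmax 0 0 1 (map2 (-) u v), argmax 0 0 1 (map2 (-) v u)))"

text \<open>\<open>rs\<close> expresses the original exponents as affine forms in the current ones; running out of fuel
  returns \<open>rs\<close> unchanged, which is sound.\<close>

fun solve :: "nat \<Rightarrow> int \<Rightarrow> nat \<Rightarrow> mpoly \<Rightarrow> nat list list \<Rightarrow> nat list list list" where
  "solve 0 b n F rs = [rs]"
| "solve (Suc f) b n F rs = (let G = strip b F in
     if G = [] then [rs] else if contradictory b G then [] else
     case pivot G of (i, j) \<Rightarrow>
       if i = 0 \<or> i \<ge> n \<or> j \<ge> n \<or> i = j then [rs]
       else if j = 0 then
         solve f b n (merge b (map (\<lambda>(c, es). (c, es[i := 0])) G)) (map (\<lambda>r. r[i := 0]) rs) @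
         solve f b n (map (\<lambda>(c, es). (c, shift i 0 es)) G) (map (shift i 0) rs)
       else
         solve f b n (map (\<lambda>(c, es). (c, shift i j es)) G) (map (shift i j) rs) @
         solve f b n (map (\<lambda>(c, es). (c, shift j 0 es)) (map (\<lambda>(c, es). (c, shift j i es)) G))
           (map (shift j 0) (map (shift j i) rs)))"

definition trim :: "nat list \<Rightarrow> nat list" where
  "trim r = rev (dropWhile (\<lambda>e. e = 0) (rev r))"

section \<open>Soundness of the solver\<close>

definition dot :: "nat list \<Rightarrow> (nat \<Rightarrow> nat) \<Rightarrow> nat" where
  "dot es x = (\<Sum>i<length es. es ! i * x i)"

definition tval :: "int \<Rightarrow> (nat \<Rightarrow> nat) \<Rightarrow> int \<times> nat list \<Rightarrow> int" where
  "tval p x t = fst t * p ^ dot (snd t) x"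

definition val :: "int \<Rightarrow> (nat \<Rightarrow> nat) \<Rightarrow> mpoly \<Rightarrow> int" where
  "val p x F = sum_list (map (tval p x) F)"

definition arity :: "nat \<Rightarrow> mpoly \<Rightarrow> bool" where
  "arity n F \<longleftrightarrow> (\<forall>t\<in>set F. length (snd t) = n)"

section \<open>Affine forms in the exponents\<close>

lemma dot_Nil [simp]: "dot [] x = 0"
  by (simp add: dot_def)

lemma dot_Cons [simp]: "dot (e # es) x = e * x 0 + dot es (\<lambda>i. x (Suc i))"
  by (simp add: dot_def sum.lessThan_Suc_shift del: sum.lessThan_Suc)

lemma dot_replicate_0 [simp]: "dot (replicate n 0) x = 0"
  by (simp add: dot_def)

lemma dot_append: "dot (es @ fs) x = dot es x + dot fs (\<lambda>i. x (length es + i))"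
  by (induction es arbitrary: x) auto

lemma dot_list_update: "i < length es \<Longrightarrow> dot (es[i := v]) x + es ! i * x i = dot es x + v * x i"
proof (induction es arbitrary: i x)
  case (Cons e es)
  then show ?case using Cons.IH[of "i - 1" "\<lambda>i. x (Suc i)"] by (cases i) auto
qed simp

lemma dot_fun_upd: "i < length es \<Longrightarrow> dot es (x(i := v)) + es ! i * x i = dot es x + es ! i * v"
proof (induction es arbitrary: i x)
  case (Cons e es)
  show ?case
  proof (cases i)
    case 0
    then have "(\<lambda>j. (x(i := v)) (Suc j)) = (\<lambda>j. x (Suc j))" by auto
    then show ?thesis using 0 by simp
  next
    case (Suc k)
    then have "(\<lambda>j. (x(i := v)) (Suc j)) = (\<lambda>j. x (Suc j))(k := v)" by auto
    then show ?thesis using Suc Cons.prems Cons.IH[of k "\<lambda>j. x (Suc j)"] by simp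
  qed
qed simp

lemma length_shift [simp]: "length (shift i j es) = length es"
  by (simp add: shift_def)

lemma dot_shift:
  assumes "i < length es" "j < length es" "i \<noteq> j"
  shows "dot (shift i j es) x = dot es (x(i := x i + x j))"
  using dot_list_update[OF assms(2), of "es ! j + es ! i" x] dot_fun_upd[OF assms(1), of x "x i + x j"]
  by (simp add: shift_def algebra_simps)

lemma dot_zero: "x i = 0 \<Longrightarrow> dot (es[i := 0]) x = dot es x"
  using dot_list_update[of i es 0 x] by (cases "i < length es") (auto simp: list_update_beyond)

lemma dot_trim: "dot (trim r) x = dot r x"
proof (induction r rule: rev_induct)
  case (snoc e r)
  then show ?case by (auto simp: trim_def dot_append)
qed (simp add: trim_def)

lemma dot_map2_add: "length es = length fs \<Longrightarrow> dot (map2 (+) es fs) x = dot es x + dot fs x"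
  by (induction es fs arbitrary: x rule: list_induct2) (auto simp: algebra_simps)

lemma dot_map2_diff: "list_all2 (\<le>) m es \<Longrightarrow> dot (map2 (-) es m) x + dot m x = dot es x"
proof (induction m es arbitrary: x rule: list_all2_induct)
  case (Cons e es f fs)
  have "(f - e) * x 0 + e * x 0 = f * x 0" using Cons(1) by (simp flip: add_mult_distrib)
  then show ?case using Cons(3)[of "\<lambda>i. x (Suc i)"] by simp
qed simp

section \<open>Values of polynomials and removal of monomial factors\<close>

lemma val_Nil [simp]: "val p x [] = 0"
  and val_Cons [simp]: "val p x (t # F) = tval p x t + val p x F"
  and val_append [simp]: "val p x (F @ G) = val p x F + val p x G"
  by (auto simp: val_def)

lemma arity_Nil [simp]: "arity n []"
  and arity_Cons [simp]: "arity n (t # F) \<longleftrightarrow> length (snd t) = n \<and> arity n F"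
  and arity_append [simp]: "arity n (F @ G) \<longleftrightarrow> arity n F \<and> arity n G"
  by (auto simp: arity_def)

lemma val_map_cong:
  "(\<And>t. t \<in> set F \<Longrightarrow> tval p y (f t) = tval p x t) \<Longrightarrow> val p y (map f F) = val p x F"
  unfolding val_def map_map by (rule arg_cong[where f = sum_list]) simp

lemma mulpow: "mulpow b e c = c * b ^ e"
  by (induction b e c rule: mulpow.induct) (auto simp: algebra_simps)

lemma tval_pull: "x 0 = 1 \<Longrightarrow> tval b x (pull f b c es) = tval b x (c, es)"
proof (induction f b c es rule: pull.induct)
  case (1 f b c e es)
  then show ?case by (auto simp: tval_def algebra_simps mod_eq_0_iff_dvd)
qed (simp_all add: tval_def)

lemma length_pull [simp]: "length (snd (pull f b c es)) = length es"
  by (induction f b c es rule: pull.induct) auto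

lemma tval_collapse: "x 0 = 1 \<Longrightarrow> b = 0 \<or> b = p \<Longrightarrow> tval p x (collapse b c es) = tval p x (c, es)"
  by (cases es) (auto simp: tval_def mulpow power_add)

lemma length_collapse [simp]: "length (snd (collapse b c es)) = length es"
  by (cases es) auto

lemma val_insert_term: "val p x (insert_term c es F) = tval p x (c, es) + val p x F"
  by (induction c es F rule: insert_term.induct) (auto simp: tval_def algebra_simps)

lemma arity_insert_term: "length es = n \<Longrightarrow> arity n F \<Longrightarrow> arity n (insert_term c es F)"
  by (induction c es F rule: insert_term.induct) auto

lemma val_collect: "x 0 = 1 \<Longrightarrow> b = 0 \<or> b = p \<Longrightarrow> val p x (collect b F G) = val p x F + val p x G"
proof (induction b F G rule: collect.induct)
  case (2 b c es F G)
  then show ?case using tval_collapse[of x b p c es]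
    by (cases "collapse b c es") (simp add: val_insert_term)
qed simp

lemma arity_collect: "arity n F \<Longrightarrow> arity n G \<Longrightarrow> arity n (collect b F G)"
proof (induction b F G rule: collect.induct)
  case (2 b c es F G)
  then show ?case using length_collapse[of b c es]
    by (cases "collapse b c es") (simp add: arity_insert_term)
qed simp

lemma val_filter: "val p x (filter (\<lambda>(c, es). c \<noteq> 0) F) = val p x F"
  by (induction F) (auto simp: tval_def)

lemma val_merge: "x 0 = 1 \<Longrightarrow> b = 0 \<or> b = p \<Longrightarrow> val p x (merge b F) = val p x F"
  by (simp add: merge_def val_filter val_collect)

lemma arity_merge: "arity n F \<Longrightarrow> arity n (merge b F)"
  using arity_collect[of n F "[]" b] by (auto simp: merge_def arity_def)

lemma length_common: "F \<noteq> [] \<Longrightarrow> arity n F \<Longrightarrow> length (common F) = n"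
  by (induction F rule: common.induct) auto

lemma common_le: "arity n F \<Longrightarrow> t \<in> set F \<Longrightarrow> list_all2 (\<le>) (common F) (snd t)"
proof (induction F rule: common.induct)
  case (3 c es u F)
  have len: "length (common (u # F)) = n" using 3 length_common[of "u # F" n] by simp
  show ?case
  proof (cases "t = (c, es)")
    case True
    then show ?thesis using 3 len by (auto simp: list_all2_conv_all_nth)
  next
    case False
    then have "list_all2 (\<le>) (common (u # F)) (snd t)" using 3 by auto
    then show ?thesis using 3 len by (auto simp: list_all2_conv_all_nth min.coboundedI2)
  qed
qed (auto simp: list_all2_conv_all_nth)

lemma arity_strip: "arity n F \<Longrightarrow> arity n (strip b F)"
proof -
  assume F: "arity n F"
  define G where "G = (if b = 0 then F else map (\<lambda>(c, es). pull 64 b c es) F)"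
  have "arity n G" using F by (auto simp: G_def arity_def)
  moreover from this have "G \<noteq> [] \<Longrightarrow> length (common G) = n" by (simp add: length_common)
  ultimately show ?thesis by (cases "G = []") (auto simp: strip_def arity_def simp flip: G_def)
qed

text \<open>Only whether the value is zero matters later, so the power of \<open>p\<close> that is
  split off is left anonymous.\<close>

lemma val_strip:
  assumes "arity n F" "x 0 = 1" "b = 0 \<or> b = p"
  shows "\<exists>k. val p x F = p ^ k * val p x (strip b F)"
proof -
  define G where "G = (if b = 0 then F else map (\<lambda>(c, es). pull 64 b c es) F)"
  have wfG: "arity n G" using assms(1) by (auto simp: G_def arity_def)
  have "val p x F = val p x G"
    using assms unfolding G_def by (auto intro!: val_map_cong[symmetric] simp: tval_pull)
  also have "\<dots> = p ^ dot (common G) x * val p x (strip b F)"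
  proof -
    have *: "tval p x t = p ^ dot (common G) x * tval p x (fst t, map2 (-) (snd t) (common G))"
      if "t \<in> set G" for t
      using dot_map2_diff[OF common_le[OF wfG that], of x]
      by (auto simp: tval_def simp flip: power_add mult.assoc) (metis add.commute)
    have "val p x G = sum_list (map (\<lambda>t. p ^ dot (common G) x * tval p x (fst t, map2 (-) (snd t) (common G))) G)"
      unfolding val_def using * by (metis (no_types, lifting) map_eq_conv)
    also have "\<dots> = p ^ dot (common G) x * val p x (strip b F)"
      by (simp add: strip_def val_def sum_list_const_mult o_def case_prod_beta flip: G_def)
    finally show ?thesis .
  qed
  finally show ?thesis by blast
qed

definition base :: "int \<Rightarrow> int \<Rightarrow> bool" where
  "base b p \<longleftrightarrow> b = p \<and> p \<ge> 2 \<or> b = 0 \<and> p \<ge> 11"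

section \<open>Polynomials without zeros\<close>

lemma val_pos: "F \<noteq> [] \<Longrightarrow> p > 0 \<Longrightarrow> list_all (\<lambda>(c, es). c > 0) F \<Longrightarrow> val p x F > 0"
proof (induction F)
  case (Cons t F)
  then have "tval p x t > 0" by (auto simp: tval_def case_prod_beta)
  moreover have "val p x F \<ge> 0" using Cons by (cases "F = []") (auto simp: order.strict_implies_order)
  ultimately show ?case by simp
qed simp

lemma val_neg: "F \<noteq> [] \<Longrightarrow> p > 0 \<Longrightarrow> list_all (\<lambda>(c, es). c < 0) F \<Longrightarrow> val p x F < 0"
proof (induction F)
  case (Cons t F)
  then have "tval p x t < 0" by (auto simp: tval_def case_prod_beta mult_neg_pos)
  moreover have "val p x F \<le> 0" using Cons by (cases "F = []") (auto simp: order.strict_implies_order)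
  ultimately show ?case by simp
qed simp

lemma val_mod: "(p - 1) dvd val p x F - sum_list (map fst F)" for p :: int
proof (induction F)
  case (Cons t F)
  have "(p - 1) dvd p ^ dot (snd t) x - 1" by (simp add: power_diff_1_eq)
  then have "(p - 1) dvd fst t * (p ^ dot (snd t) x - 1)" by simp
  with Cons have "(p - 1) dvd fst t * (p ^ dot (snd t) x - 1) + (val p x F - sum_list (map fst F))"
    by (rule dvd_add[rotated])
  then show ?case by (simp add: tval_def algebra_simps)
qed simp

lemma val_filter_dvd:
  assumes "x 0 = 1" "arity n F" "n > 0"
  shows "p dvd val p x F - val p x (filter (\<lambda>(c, es). hd es = 0) F)"
  using assms(2)
proof (induction F)
  case (Cons t F)
  obtain c e es where t: "t = (c, e # es)"
    using Cons.prems assms(3) by (cases t; cases "snd t") auto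
  show ?case using Cons t assms(1)
    by (cases e) (auto simp: tval_def algebra_simps power_add)
qed simp

lemma dot_all_zero: "list_all (\<lambda>e. e = 0) es \<Longrightarrow> dot es x = 0"
  by (induction es arbitrary: x) auto

lemma contradictory_sound:
  assumes F: "arity n F" "n > 0" and ne: "F \<noteq> []" and x: "x 0 = 1" and b: "base b p"
    and contradictory: "contradictory b F"
  shows "val p x F \<noteq> 0"
proof
  assume 0: "val p x F = 0"
  have p: "p \<ge> 2" using b by (auto simp: base_def)
  define s where "s = sum_list (map fst F)"
  have s: "(p - 1) dvd s" using val_mod[of p x F] 0 by (simp add: s_def)
  have s': "\<not> (if b = 0 then s \<noteq> 0 \<and> \<bar>s\<bar> < 10 else s mod (b - 1) \<noteq> 0)"
  proof (cases "b = 0")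
    case True
    then show ?thesis using b s zdvd_imp_le[of "p - 1" "\<bar>s\<bar>"] by (auto simp: base_def)
  next
    case False
    then show ?thesis using b s by (auto simp: base_def)
  qed
  have "\<not> list_all (\<lambda>(c, es). c > 0) F" "\<not> list_all (\<lambda>(c, es). c < 0) F"
    using val_pos[of F p x] val_neg[of F p x] ne p 0 by auto
  with contradictory s' obtain t where t: "filter (\<lambda>(c, es). hd es = 0) F = [t]" "list_all (\<lambda>e. e = 0) (snd t)"
    "if b = 0 then fst t \<noteq> 0 \<and> \<bar>fst t\<bar> < 11 else fst t mod b \<noteq> 0"
    unfolding contradictory_def Let_def s_def[symmetric]
    by (cases "filter (\<lambda>(c, es). hd es = 0) F") (auto split: list.splits)
  \<comment> \<open>Modulo \<open>p\<close> the value reduces to the single term \<open>t\<close>,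
    whose monomial is 1.\<close>
  have "p dvd fst t"
    using val_filter_dvd[of x n F p] x F 0 t(1,2) by (simp add: tval_def dot_all_zero)
  then show False
    using b t(3) zdvd_imp_le[of p "\<bar>fst t\<bar>"] by (auto simp: base_def split: if_splits)
qed

lemma shift_sound:
  assumes "arity n F" "i < n" "j < n" "i \<noteq> j" "list_all (\<lambda>r. length r = n) rs"
  shows "val p x (map (\<lambda>(c, es). (c, shift i j es)) F) = val p (x(i := x i + x j)) F"
    and "map (\<lambda>r. dot r x) (map (shift i j) rs) = map (\<lambda>r. dot r (x(i := x i + x j))) rs"
    and "arity n (map (\<lambda>(c, es). (c, shift i j es)) F)"
    and "list_all (\<lambda>r. length r = n) (map (shift i j) rs)"
proof -
  show "val p x (map (\<lambda>(c, es). (c, shift i j es)) F) = val p (x(i := x i + x j)) F"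
    using assms by (intro val_map_cong) (auto simp: tval_def dot_shift arity_def)
  show "map (\<lambda>r. dot r x) (map (shift i j) rs) = map (\<lambda>r. dot r (x(i := x i + x j))) rs"
    using assms by (auto simp: dot_shift list_all_iff)
qed (use assms in \<open>auto simp: arity_def list_all_iff\<close>)

text \<open>Only a covering is asserted: some family reproduces the values of the forms
  \<open>rs\<close> at \<open>x\<close>. That all members of a family are solutions is not claimed,
  which makes early stopping harmless.\<close>

definition parametrised :: "nat list list \<Rightarrow> (nat \<Rightarrow> nat) \<Rightarrow> nat list list list \<Rightarrow> bool" where
  "parametrised rs x S \<longleftrightarrow> (\<exists>r\<in>set S. \<exists>y. y 0 = 1 \<and> map (\<lambda>r. dot r x) rs = map (\<lambda>r. dot r y) r)"

lemma parametrised_append: "parametrised rs x S \<or> parametrised rs x T \<Longrightarrow> parametrised rs x (S @ T)"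
  by (auto simp: parametrised_def)

lemma parametrised_cong:
  "map (\<lambda>r. dot r x) rs = map (\<lambda>r. dot r y) rs' \<Longrightarrow> parametrised rs x S = parametrised rs' y S"
  by (simp add: parametrised_def)

text \<open>The two subproblems of a branch cover all points after a change of exponents, so the
  induction on the fuel keeps \<open>F\<close>, \<open>rs\<close> and \<open>x\<close> arbitrary. No
  termination argument enters: giving up returns \<open>rs\<close>, for which \<open>x\<close>
  itself is the witness.\<close>

lemma solve_sound:
  assumes b: "base b p" and n: "n > 0"
  shows "arity n F \<Longrightarrow> list_all (\<lambda>r. length r = n) rs \<Longrightarrow> x 0 = 1 \<Longrightarrow> val p x F = 0 \<Longrightarrow>
    parametrised rs x (solve f b n F rs)"
proof (induction f arbitrary: F rs x)
  case 0
  then show ?case by (auto simp: parametrised_def)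
next
  case (Suc f)
  define G where "G = strip b F"
  obtain i j where ij: "pivot G = (i, j)" by fastforce
  have G: "arity n G" using Suc.prems by (simp add: G_def arity_strip)
  have b': "b = 0 \<or> b = p" "p \<noteq> 0" using b by (auto simp: base_def)
  have G0: "val p x G = 0"
    using val_strip[of n F x b p] Suc.prems b' by (auto simp: G_def)
  \<comment> \<open>\<open>x'\<close> is the old point and \<open>y\<close> the same point in the
    new exponents; all three substitution branches end with this step.\<close>
  have step: "parametrised rs' x' (solve f b n (map (\<lambda>(c, es). (c, shift i j es)) G') (map (shift i j) rs'))"
    if "arity n G'" "list_all (\<lambda>r. length r = n) rs'" "i < n" "j < n" "i \<noteq> j"
      "y 0 = 1" "y(i := y i + y j) = x'" "val p x' G' = 0" for i j G' rs' x' y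
    using Suc.IH[of "map (\<lambda>(c, es). (c, shift i j es)) G'" "map (shift i j) rs'" y]
      shift_sound(1)[OF that(1,3,4,5,2), of p y] shift_sound(2)[OF that(1,3,4,5,2), of y]
      shift_sound(3,4)[OF that(1,3,4,5,2)] that parametrised_cong[of y "map (shift i j) rs'" x' rs']
    by simp
  consider "G = [] \<or> i = 0 \<or> i \<ge> n \<or> j \<ge> n \<or> i = j" "\<not> contradictory b G \<or> G = []"
    | "contradictory b G" "G \<noteq> []"
    | "\<not> contradictory b G" "G \<noteq> []" "i \<noteq> 0" "i < n" "j < n" "i \<noteq> j" by linarith
  then show ?case
  proof cases
    case 1
    then have "solve (Suc f) b n F rs = [rs]"
      by (auto simp: Let_def ij simp flip: G_def)
    then show ?thesis using Suc.prems by (auto simp: parametrised_def)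
  next
    case 2
    then show ?thesis using contradictory_sound[of n G x b p] G n Suc.prems(3) b G0 by blast
  next
    case 3
    show ?thesis
    proof (cases "j = 0")
      case j: True
      define G1 where "G1 = merge b (map (\<lambda>(c, es). (c, es[i := 0])) G)"
      have eq: "solve (Suc f) b n F rs = solve f b n G1 (map (\<lambda>r. r[i := 0]) rs) @
         solve f b n (map (\<lambda>(c, es). (c, shift i 0 es)) G) (map (shift i 0) rs)"
        using 3 j by (simp add: Let_def ij G1_def flip: G_def)
      show ?thesis
      proof (cases "x i = 0")
        case True
        have "val p x (map (\<lambda>(c, es). (c, es[i := 0])) G) = 0"
          unfolding G0[symmetric] by (rule val_map_cong) (auto simp: tval_def dot_zero True)
        then have "val p x G1 = 0"
          using Suc.prems(3) b' by (simp add: G1_def val_merge)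
        moreover have "arity n G1"
          unfolding G1_def using G by (intro arity_merge) (auto simp: arity_def)
        ultimately have "parametrised (map (\<lambda>r. r[i := 0]) rs) x (solve f b n G1 (map (\<lambda>r. r[i := 0]) rs))"
          using Suc.prems by (intro Suc.IH) (auto simp: list_all_iff)
        moreover have "map (\<lambda>r. dot r x) (map (\<lambda>r. r[i := 0]) rs) = map (\<lambda>r. dot r x) rs"
          using True by (simp add: dot_zero)
        ultimately show ?thesis unfolding eq by (metis parametrised_append parametrised_cong)
      next
        case False
        then have "parametrised rs x (solve f b n (map (\<lambda>(c, es). (c, shift i 0 es)) G) (map (shift i 0) rs))"
          using 3 n G0 Suc.prems G by (intro step[where y = "x(i := x i - 1)"]) auto
        then show ?thesis unfolding eq by (simp add: parametrised_append)
      qed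
    next
      case j: False
      define H where "H = map (\<lambda>(c, es). (c, shift j i es)) G"
      have eq: "solve (Suc f) b n F rs =
         solve f b n (map (\<lambda>(c, es). (c, shift i j es)) G) (map (shift i j) rs) @
         solve f b n (map (\<lambda>(c, es). (c, shift j 0 es)) H) (map (shift j 0) (map (shift j i) rs))"
        using 3 j by (simp add: Let_def ij H_def del: map_map flip: G_def)
      show ?thesis
      proof (cases "x i \<ge> x j")
        case True
        then have "parametrised rs x (solve f b n (map (\<lambda>(c, es). (c, shift i j es)) G) (map (shift i j) rs))"
          using 3 G0 Suc.prems G by (intro step[where y = "x(i := x i - x j)"]) auto
        then show ?thesis unfolding eq by (simp add: parametrised_append)
      next
        case False
        \<comment> \<open>The strict case takes two substitutions: exponent \<open>j\<close> becomes
          \<open>z j + x i\<close>, and \<open>z j\<close> is positive, hence a successor.\<close>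
        define z where "z = x(j := x j - x i)"
        have z: "z(j := z j + z i) = x" using False 3 by (auto simp: z_def)
        have H: "val p z H = 0" "arity n H" "list_all (\<lambda>r. length r = n) (map (shift j i) rs)"
          "map (\<lambda>r. dot r z) (map (shift j i) rs) = map (\<lambda>r. dot r x) rs"
          using shift_sound(1)[OF G _ _ _ Suc.prems(2), of j i p z] shift_sound(2)[OF G _ _ _ Suc.prems(2), of j i z]
            shift_sound(3,4)[OF G _ _ _ Suc.prems(2), of j i] 3 z G0 by (simp_all add: H_def)
        have "parametrised (map (shift j i) rs) z (solve f b n (map (\<lambda>(c, es). (c, shift j 0 es)) H)
            (map (shift j 0) (map (shift j i) rs)))"
          using 3 j n H(1,3) False Suc.prems(3)
          by (intro step[where y = "x(j := x j - x i - 1)"] H(2)) (auto simp: z_def Suc_diff_Suc)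
        then show ?thesis
          using parametrised_cong[OF H(4)] unfolding eq by (simp add: parametrised_append)
      qed
    qed
  qed
qed

section \<open>The equations between FM-exponents\<close>

definition pmul :: "mpoly \<Rightarrow> mpoly \<Rightarrow> mpoly" where
  "pmul F G = concat (map (\<lambda>(c, es). map (\<lambda>(d, fs). (c * d, map2 (+) es fs)) G) F)"

text \<open>\<open>Plus d\<close> starts at exponent \<open>d\<close> to allow for the condition
  \<open>a > 0\<close> of form (i) at \<open>p = 2\<close>. \<open>Half\<close> and
  \<open>Alt\<close> are forms (ii) and (iii).\<close>

datatype shape = Const int | Plus nat | Half | Alt

text \<open>For \<open>Alt\<close>, \<open>a = u + 1\<close> and \<open>b = 2 * m + 3\<close> give
  \<open>a * b = 3 + 3 * u + 2 * w\<close> with \<open>w = (u + 1) * m\<close>, which is affine in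
  \<open>u\<close> and \<open>w\<close>.\<close>

fun num :: "shape \<Rightarrow> nat \<Rightarrow> mpoly" where
  "num (Const c) i = [(c, replicate 8 0)]"
| "num (Plus d) i = [(1, (replicate 8 0)[0 := d, i := 1]), (1, replicate 8 0)]"
| "num Half i = [(1, (replicate 8 0)[i := 1]), (1, replicate 8 0)]"
| "num Alt i = [(1, (replicate 8 0)[0 := 3, i := 3, Suc i := 2]), (1, replicate 8 0)]"

fun den :: "shape \<Rightarrow> nat \<Rightarrow> mpoly" where
  "den Half i = [(2, replicate 8 0)]"
| "den Alt i = [(1, (replicate 8 0)[0 := 1, i := 1]), (1, replicate 8 0)]"
| "den _ i = [(1, replicate 8 0)]"

text \<open>\<open>A + p ^ (d + e * k) * B = p ^ (f + g * k) * C\<close> with cleared denominators; variable 0 stands for \<open>p\<close>,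
  1 for \<open>p ^ k\<close>, and 2, 4, 6 (with 3, 5, 7 for \<open>Alt\<close>) belong to \<open>A\<close>, \<open>B\<close>, \<open>C\<close>.\<close>

definition equation :: "nat \<Rightarrow> nat \<Rightarrow> nat \<Rightarrow> nat \<Rightarrow> shape \<Rightarrow> shape \<Rightarrow> shape \<Rightarrow> mpoly" where
  "equation d e f g s1 s2 s3 =
     pmul (num s1 2) (pmul (den s2 4) (den s3 6)) @
     pmul [(1, [d, e, 0,0,0,0,0,0])] (pmul (num s2 4) (pmul (den s1 2) (den s3 6))) @
     pmul [(-1, [f, g, 0,0,0,0,0,0])] (pmul (num s3 6) (pmul (den s1 2) (den s2 4)))"

text \<open>The exponents in \<open>C\<close> are not recorded, since \<open>A\<close> and \<open>B\<close> determine it.\<close>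

definition start :: "nat list list" where
  "start = map (\<lambda>i. (replicate 8 0)[i := 1]) [1..<6]"

definition run :: "int \<Rightarrow> nat \<Rightarrow> nat \<Rightarrow> nat \<Rightarrow> nat \<Rightarrow> shape \<Rightarrow> shape \<Rightarrow> shape \<Rightarrow> nat list list list" where
  "run b d e f g s1 s2 s3 = map (map trim) (solve 60 b 8 (merge b (equation d e f g s1 s2 s3)) start)"

lemma arity_pmul: "arity n F \<Longrightarrow> arity n G \<Longrightarrow> arity n (pmul F G)"
  by (fastforce simp: pmul_def arity_def)

lemma val_pmul: "arity n F \<Longrightarrow> arity n G \<Longrightarrow> val p x (pmul F G) = val p x F * val p x G"
proof (induction F)
  case (Cons t F)
  obtain c es where t: "t = (c, es)" by fastforce
  have "val p x (map (\<lambda>(d, fs). (c * d, map2 (+) es fs)) G) = tval p x t * val p x G"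
    using Cons.prems(2)
  proof (induction G)
    case (Cons u G)
    then show ?case using Cons.prems \<open>arity n (t # F)\<close>
      by (cases u) (auto simp: t tval_def dot_map2_add power_add algebra_simps)
  qed simp
  then show ?case using Cons by (simp add: pmul_def t algebra_simps)
qed (simp add: pmul_def)

text \<open>An exponent \<open>b = 1\<close> in form (iii) is covered by the constant shape or by \<open>Half\<close>, so \<open>b = 2 * m + 3\<close>;
  the product \<open>a * m\<close> is treated as an independent variable \<open>w\<close> by the solver.\<close>

fun represents :: "nat \<Rightarrow> shape \<Rightarrow> nat \<Rightarrow> nat \<Rightarrow> nat \<Rightarrow> bool" where
  "represents p (Const c) u w n \<longleftrightarrow> int n = c"
| "represents p (Plus d) u w n \<longleftrightarrow> n = p ^ (d + u) + 1"
| "represents p Half u w n \<longleftrightarrow> 2 * n = p ^ u + 1"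
| "represents p Alt u w n \<longleftrightarrow> (\<exists>m. w = Suc u * m \<and> (p ^ Suc u + 1) * n = p ^ (3 + 3 * u + 2 * w) + 1)"

lemma represents_val:
  assumes "represents p s (x i) (x (Suc i)) n" "i \<in> {2, 4, 6}" "x 0 = 1"
  shows "val (int p) x (den s i) * int n = val (int p) x (num s i)"
proof (cases s)
  case Alt
  then have "(p ^ Suc (x i) + 1) * n = p ^ (3 + 3 * x i + 2 * x (Suc i)) + 1" using assms(1) by auto
  from arg_cong[OF this, of int]
  have "(int p ^ Suc (x i) + 1) * int n = int p ^ (3 + 3 * x i + 2 * x (Suc i)) + 1" by (simp add: algebra_simps)
  then show ?thesis using assms(2,3) Alt
    by (auto simp: tval_def eval_nat_numeral power_add algebra_simps)
next
  case Half
  then have "2 * n = p ^ x i + 1" using assms(1) by simp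
  from arg_cong[OF this, of int]
  have "2 * int n = int p ^ x i + 1" by simp
  then show ?thesis using assms(2,3) Half by (auto simp: tval_def eval_nat_numeral)
qed (use assms in \<open>auto simp: tval_def eval_nat_numeral power_add\<close>)

lemma arity_num [simp]: "arity 8 (num s i)" and arity_den [simp]: "arity 8 (den s i)"
  by (cases s; simp)+

lemma run_sound:
  assumes b: "base b (int p)"
    and rep: "represents p s1 u1 w1 n1" "represents p s2 u2 w2 n2" "represents p s3 u3 w3 n3"
    and eq: "n1 + p ^ (d + e * k) * n2 = p ^ (f + g * k) * n3"
  obtains r y where "r \<in> set (run b d e f g s1 s2 s3)" "y 0 = 1" "length r = 5" "dot (r ! 0) y = k"
    "dot (r ! 1) y = u1" "dot (r ! 2) y = w1" "dot (r ! 3) y = u2" "dot (r ! 4) y = w2"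
proof -
  define x where "x = nth [1, k, u1, w1, u2, w2, u3, w3]"
  have x: "x 0 = 1" "x 1 = k" "x 2 = u1" "x 3 = w1" "x 4 = u2" "x 5 = w2" "x 6 = u3" "x 7 = w3"
    by (simp_all add: x_def)
  let ?F = "equation d e f g s1 s2 s3"
  let ?v = "val (int p) x"
  have r: "?v (den s1 2) * int n1 = ?v (num s1 2)" "?v (den s2 4) * int n2 = ?v (num s2 4)"
    "?v (den s3 6) * int n3 = ?v (num s3 6)"
    using rep x by (intro represents_val; simp add: eval_nat_numeral)+
  have ar: "arity 8 ?F" by (simp add: equation_def arity_pmul)
  have "?v ?F = ?v (num s1 2) * (?v (den s2 4) * ?v (den s3 6))
      + int p ^ (d + e * k) * (?v (num s2 4) * (?v (den s1 2) * ?v (den s3 6)))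
      - int p ^ (f + g * k) * (?v (num s3 6) * (?v (den s1 2) * ?v (den s2 4)))"
    using x by (simp add: equation_def val_pmul[where n = 8] arity_pmul tval_def)
  also have "\<dots> = ?v (den s1 2) * ?v (den s2 4) * ?v (den s3 6) *
     (int n1 + int p ^ (d + e * k) * int n2 - int p ^ (f + g * k) * int n3)"
    unfolding r[symmetric] by (simp add: algebra_simps)
  also have "int n1 + int p ^ (d + e * k) * int n2 - int p ^ (f + g * k) * int n3 = 0"
    using arg_cong[OF eq, of int] by simp
  finally have "?v (merge b ?F) = 0" using b x by (subst val_merge) (auto simp: base_def)
  moreover have "list_all (\<lambda>r. length r = 8) start" by (simp add: start_def list_all_iff)
  ultimately obtain r y where r: "r \<in> set (solve 60 b 8 (merge b ?F) start)" and y: "y 0 = 1"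
    and eq: "map (\<lambda>r. dot r x) start = map (\<lambda>r. dot r y) r"
    using solve_sound[of b "int p" 8 "merge b ?F" start x 60] b arity_merge[OF ar] x
    by (auto simp: parametrised_def)
  have "map (\<lambda>r. dot r x) start = [k, u1, w1, u2, w2]"
    using x by (simp add: start_def eval_nat_numeral upt_rec)
  then have eq: "map (\<lambda>r. dot r y) (map trim r) = [k, u1, w1, u2, w2]"
    using eq by (simp add: o_def dot_trim)
  have "length (map (\<lambda>r. dot r y) (map trim r)) = 5" unfolding eq by simp
  then have "length (map trim r) = 5" by simp
  moreover from this have "dot (map trim r ! i) y = [k, u1, w1, u2, w2] ! i" if "i < 5" for i
    using that unfolding eq[symmetric] by simp
  from this[of 0] this[of 1] this[of 2] this[of 3] this[of 4] calculation
  show thesis using r y by (intro that[of "map trim r" y]) (auto simp: run_def)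
qed

section \<open>Solution tables for the two types of equation\<close>

fun pairs :: "'a list \<Rightarrow> ('a \<times> 'a) list" where
  "pairs [] = []"
| "pairs (s # ss) = map (Pair s) (s # ss) @ pairs ss"

text \<open>The case of \<open>A + B\<close> prime to \<open>p\<close>. The offset \<open>d\<close>
  bounds the exponent of \<open>p\<close> in \<open>B\<close> from below; it is taken as 1 for
  \<open>p = 2\<close>, where prime-to-\<open>p\<close> parts are odd, and as 0 otherwise.\<close>

definition diff_table :: "int \<Rightarrow> nat \<Rightarrow> shape list \<Rightarrow> (shape \<times> shape \<times> nat list list) list" where
  "diff_table b d ss = concat (map (\<lambda>(s1, s2, s3). map (\<lambda>r. (s1, s2, r)) (run b d 1 0 0 s1 s2 s3))
     (List.product ss (List.product ss ss)))"

text \<open>The case of \<open>A + B\<close> divisible by \<open>p\<close>, whence the exponent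
  \<open>1 + k\<close>. Both summands are then prime to \<open>p\<close> and interchangeable, so
  unordered pairs suffice; the row of \<open>k\<close> is blanked because that power belongs to the
  sum, not to \<open>B\<close>.\<close>

definition sum_table :: "int \<Rightarrow> shape list \<Rightarrow> (shape \<times> shape \<times> nat list list) list" where
  "sum_table b ss = concat (map (\<lambda>((s1, s2), s3). map (\<lambda>r. (s1, s2, [] # tl r)) (run b 0 0 1 1 s1 s2 s3))
     (List.product (pairs ss) ss))"

text \<open>The rows of a table entry are the affine forms for \<open>k\<close> and for the two exponents of each summand.\<close>

definition entry_listed :: "nat \<Rightarrow> nat \<Rightarrow> shape \<times> shape \<times> nat list list \<Rightarrow> bool" where
  "entry_listed p d e \<longleftrightarrow> (\<forall>y A B. y 0 = 1 \<longrightarrow>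
     (case e of (s1, s2, r) \<Rightarrow>
       represents p s1 (dot (r ! 1) y) (dot (r ! 2) y) A \<longrightarrow>
       represents p s2 (dot (r ! 3) y) (dot (r ! 4) y) B \<longrightarrow>
       listed_pair p A (p ^ (d + dot (r ! 0) y) * B) \<or> listed_pair p (p ^ (d + dot (r ! 0) y) * B) A))"

lemma diff_listed:
  assumes tab: "list_all (entry_listed p d) (diff_table b d ss)" and b: "base b (int p)"
    and s: "s1 \<in> set ss" "s2 \<in> set ss" "s3 \<in> set ss"
    and rep: "represents p s1 u1 w1 A" "represents p s2 u2 w2 B" "represents p s3 u3 w3 C"
    and eq: "A + p ^ (d + k) * B = C"
  shows "listed_pair p A (p ^ (d + k) * B) \<or> listed_pair p (p ^ (d + k) * B) A"
proof -
  have "A + p ^ (d + 1 * k) * B = p ^ (0 + 0 * k) * C" using eq by simp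
  then obtain r y where r: "r \<in> set (run b d 1 0 0 s1 s2 s3)" and y: "y 0 = 1" and "length r = 5"
    and xy: "dot (r ! 0) y = k" "dot (r ! 1) y = u1" "dot (r ! 2) y = w1" "dot (r ! 3) y = u2" "dot (r ! 4) y = w2"
    by (rule run_sound[OF b rep])
   have "entry_listed p d (s1, s2, r)"
    using tab s r unfolding diff_table_def list_all_iff by force
  then show ?thesis using y rep xy unfolding entry_listed_def by auto
qed

lemma pairs_cases: "s1 \<in> set ss \<Longrightarrow> s2 \<in> set ss \<Longrightarrow> (s1, s2) \<in> set (pairs ss) \<or> (s2, s1) \<in> set (pairs ss)"
  by (induction ss) auto

lemma sum_listed:
  assumes tab: "list_all (entry_listed p 0) (sum_table b ss)" and b: "base b (int p)"
    and s: "s1 \<in> set ss" "s2 \<in> set ss" "s3 \<in> set ss"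
    and rep: "represents p s1 u1 w1 A" "represents p s2 u2 w2 B" "represents p s3 u3 w3 C"
    and eq: "A + B = p ^ Suc k * C"
  shows "listed_pair p A B \<or> listed_pair p B A"
proof -
  have ordered: "listed_pair p A B \<or> listed_pair p B A"
    if s12: "(s1, s2) \<in> set (pairs ss)" and rep: "represents p s1 u1 w1 A" "represents p s2 u2 w2 B"
      and eq: "A + B = p ^ Suc k * C" for s1 s2 u1 u2 w1 w2 A B
  proof -
    have "A + p ^ (0 + 0 * k) * B = p ^ (1 + 1 * k) * C" using eq by simp
    then obtain r y where r: "r \<in> set (run b 0 0 1 1 s1 s2 s3)" and y: "y 0 = 1" and len: "length r = 5"
      and xy: "dot (r ! 0) y = k" "dot (r ! 1) y = u1" "dot (r ! 2) y = w1" "dot (r ! 3) y = u2" "dot (r ! 4) y = w2"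
      by (rule run_sound[OF b rep assms(8)])
     have "entry_listed p 0 (s1, s2, [] # tl r)"
      using tab s12 s(3) r unfolding sum_table_def list_all_iff by force
    moreover have "tl r ! 0 = r ! 1" "tl r ! 1 = r ! 2" "tl r ! 2 = r ! 3" "tl r ! 3 = r ! 4"
      using len by (cases r; simp)+
    ultimately show ?thesis using y rep xy unfolding entry_listed_def by auto
  qed
  from pairs_cases[OF s(1,2)] show ?thesis
    using ordered[OF _ rep(1,2) eq] ordered[OF _ rep(2,1)] eq by (auto simp: add.commute)
qed

section \<open>The solutions\<close>

text \<open>To read an entry: \<open>(Plus 1, Plus 1, [[2], [4], [0, 0, 0, 1], [],
  [0, 0, 0, 0, 0, 1]])\<close> has \<open>k = 2\<close> and exponents 1 + 4 and 1 + 0, so it is the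
  pair of 33 and \<open>2 ^ 3 * 3 = 24\<close>. Slot 0 of a row is its constant part.\<close>

lemma diff_table_2:
  "diff_table 2 1 [Const 1, Plus 1, Alt] =
   [(Const 1, Const 1, [[0, 0, 0, 0, 0, 0, 1], [0, 0, 1], [0, 0, 0, 1], [0, 0, 0, 0, 1], [0, 0, 0, 0, 0, 1]]),
    (Const 1, Const 1, [[], [0, 0, 1], [0, 0, 0, 1], [0, 0, 0, 0, 1], [0, 0, 0, 0, 0, 1]]),
    (Const 1, Plus 1, [[1], [0, 0, 1], [0, 0, 0, 1], [], [0, 0, 0, 0, 0, 1]]),
    (Const 1, Plus 1, [[], [0, 0, 1], [0, 0, 0, 1], [1], [0, 0, 0, 0, 0, 1]]),
    (Const 1, Alt, [[1], [0, 0, 1], [0, 0, 0, 1], [], []]),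
    (Plus 1, Const 1, [[0, 1], [0, 1], [0, 0, 0, 1], [0, 0, 0, 0, 1], [0, 0, 0, 0, 0, 1]]),
    (Plus 1, Const 1, [[1], [2], [0, 0, 0, 1], [0, 0, 0, 0, 1], [0, 0, 0, 0, 0, 1]]),
    (Plus 1, Const 1, [[], [2], [0, 0, 0, 1], [0, 0, 0, 0, 1], [0, 0, 0, 0, 0, 1]]),
    (Plus 1, Const 1, [[2], [], [0, 0, 0, 1], [0, 0, 0, 0, 1], [0, 0, 0, 0, 0, 1]]),
    (Plus 1, Const 1, [[2], [1], [0, 0, 0, 1], [0, 0, 0, 0, 1], [0, 0, 0, 0, 0, 1]]),
    (Plus 1, Plus 1, [[0, 1], [0, 1], [0, 0, 0, 1], [], [0, 0, 0, 0, 0, 1]]),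
    (Plus 1, Plus 1, [[], [1], [0, 0, 0, 1], [], [0, 0, 0, 0, 0, 1]]),
    (Plus 1, Plus 1, [[2], [3], [0, 0, 0, 1], [1], [0, 0, 0, 0, 0, 1]]),
    (Plus 1, Plus 1, [[2], [4], [0, 0, 0, 1], [], [0, 0, 0, 0, 0, 1]]),
    (Plus 1, Plus 1, [[], [2], [0, 0, 0, 1], [3], [0, 0, 0, 0, 0, 1]]),
    (Plus 1, Plus 1, [[], [4], [0, 0, 0, 1], [1], [0, 0, 0, 0, 0, 1]]),
    (Plus 1, Plus 1, [[2], [], [0, 0, 0, 1], [1], [0, 0, 0, 0, 0, 1]]),
    (Plus 1, Plus 1, [[3], [2], [0, 0, 0, 1], [], [0, 0, 0, 0, 0, 1]]),
    (Plus 1, Plus 1, [[], [], [0, 0, 0, 1], [1], [0, 0, 0, 0, 0, 1]]),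
    (Plus 1, Alt, [[0, 1], [0, 1], [0, 0, 0, 1], [], []]), (Plus 1, Alt, [[], [1], [0, 0, 0, 1], [], []]),
    (Plus 1, Alt, [[3], [4], [0, 0, 0, 1], [1], []]), (Plus 1, Alt, [[2], [4], [0, 0, 0, 1], [], []]),
    (Plus 1, Alt, [[3], [5], [0, 0, 0, 1], [], [1]]), (Plus 1, Alt, [[1], [4], [0, 0, 0, 1], [], [2]]),
    (Plus 1, Alt, [[], [3], [0, 0, 0, 1], [1], []]), (Plus 1, Alt, [[3], [2], [0, 0, 0, 1], [], []]),
    (Plus 1, Alt, [[1], [1], [0, 0, 0, 1], [1], []]),
    (Alt, Const 1, [[0, 0, 0, 0, 0, 0, 1], [0, 0, 0, 0, 0, 0, 1], [], [0, 0, 0, 0, 1], [0, 0, 0, 0, 0, 1]]),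
    (Alt, Const 1, [[], [], [1], [0, 0, 0, 0, 1], [0, 0, 0, 0, 0, 1]]),
    (Alt, Const 1, [[2, 0, 0, 2], [], [0, 0, 0, 1], [0, 0, 0, 0, 1], [0, 0, 0, 0, 0, 1]]),
    (Alt, Plus 1, [[], [], [], [], [0, 0, 0, 0, 0, 1]]), (Alt, Plus 1, [[], [], [1], [], [0, 0, 0, 0, 0, 1]]),
    (Alt, Plus 1, [[1, 0, 1], [1, 0, 1], [], [1, 0, 1], [0, 0, 0, 0, 0, 1]]),
    (Alt, Plus 1, [[], [], [], [1], [0, 0, 0, 0, 0, 1]]), (Alt, Plus 1, [[1], [1], [2], [2], [0, 0, 0, 0, 0, 1]]),
    (Alt, Plus 1, [[], [], [3], [3], [0, 0, 0, 0, 0, 1]]),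
    (Alt, Plus 1, [[2, 0, 0, 2], [], [0, 0, 0, 1], [1], [0, 0, 0, 0, 0, 1]]),
    (Alt, Plus 1, [[5, 0, 0, 2], [1], [0, 0, 0, 1], [], [0, 0, 0, 0, 0, 1]]),
    (Alt, Alt, [[0, 0, 0, 0, 0, 0, 1], [0, 0, 0, 0, 0, 0, 1], [0, 0, 0, 0, 0, 1], [0, 0, 0, 0, 0, 0, 1], [0, 0, 0, 0, 0, 1]]),
    (Alt, Alt, [[0, 0, 0, 0, 1], [0, 0, 0, 0, 1], [1, 0, 0, 0, 1, 0, 1], [0, 0, 0, 0, 1], [0, 0, 0, 0, 0, 0, 1]]),
    (Alt, Alt, [[1], [1], [], [], [1]]), (Alt, Alt, [[1], [1], [], [2], []]),
    (Alt, Alt, [[], [2], [0, 0, 0, 0, 0, 1], [2], [0, 0, 0, 0, 0, 1]]),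
    (Alt, Alt, [[5, 0, 0, 2], [1], [0, 0, 0, 1], [], []])]"
  by code_simp

lemma sum_table_2:
  "sum_table 2 [Const 1, Plus 1, Alt] =
   [(Const 1, Const 1, [[], [0, 0, 1], [0, 0, 0, 1], [0, 0, 0, 0, 1], [0, 0, 0, 0, 0, 1]]),
    (Const 1, Plus 1, [[], [0, 0, 1], [0, 0, 0, 1], [], [0, 0, 0, 0, 0, 1]]),
    (Const 1, Plus 1, [[], [0, 0, 1], [0, 0, 0, 1], [1, 0, 0, 0, 0, 0, 1], [0, 0, 0, 0, 0, 1]]),
    (Const 1, Plus 1, [[], [0, 0, 1], [0, 0, 0, 1], [1], [0, 0, 0, 0, 0, 1]]),
    (Const 1, Alt, [[], [0, 0, 1], [0, 0, 0, 1], [], []]), (Const 1, Alt, [[], [0, 0, 1], [0, 0, 0, 1], [], [1]]),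
    (Const 1, Alt, [[], [0, 0, 1], [0, 0, 0, 1], [], [1, 0, 0, 0, 0, 0, 0, 1]]),
    (Plus 1, Plus 1, [[], [], [0, 0, 0, 1], [1], [0, 0, 0, 0, 0, 1]]),
    (Plus 1, Plus 1, [[], [1], [0, 0, 0, 1], [], [0, 0, 0, 0, 0, 1]]),
    (Plus 1, Plus 1, [[], [], [0, 0, 0, 1], [], [0, 0, 0, 0, 0, 1]]),
    (Plus 1, Plus 1, [[], [], [0, 0, 0, 1], [2, 0, 0, 0, 0, 0, 1], [0, 0, 0, 0, 0, 1]]),
    (Plus 1, Plus 1, [[], [2, 0, 0, 0, 0, 0, 1], [0, 0, 0, 1], [], [0, 0, 0, 0, 0, 1]]),
    (Plus 1, Plus 1, [[], [1, 0, 0, 0, 1], [0, 0, 0, 1], [1, 0, 0, 0, 1], [0, 0, 0, 0, 0, 1]]),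
    (Plus 1, Plus 1, [[], [], [0, 0, 0, 1], [], [0, 0, 0, 0, 0, 1]]),
    (Plus 1, Plus 1, [[], [], [0, 0, 0, 1], [2], [0, 0, 0, 0, 0, 1]]),
    (Plus 1, Plus 1, [[], [2], [0, 0, 0, 1], [], [0, 0, 0, 0, 0, 1]]),
    (Plus 1, Plus 1, [[], [3], [0, 0, 0, 1], [2], [0, 0, 0, 0, 0, 1]]),
    (Plus 1, Plus 1, [[], [3], [0, 0, 0, 1], [1], [0, 0, 0, 0, 0, 1]]),
    (Plus 1, Plus 1, [[], [1], [0, 0, 0, 1], [3], [0, 0, 0, 0, 0, 1]]),
    (Plus 1, Plus 1, [[], [2], [0, 0, 0, 1], [3], [0, 0, 0, 0, 0, 1]]),
    (Plus 1, Alt, [[], [], [0, 0, 0, 1], [1], []]), (Plus 1, Alt, [[], [1], [0, 0, 0, 1], [], []]),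
    (Plus 1, Alt, [[], [1], [0, 0, 0, 1], [], [1]]), (Plus 1, Alt, [[], [], [0, 0, 0, 1], [], []]),
    (Plus 1, Alt, [[], [1], [0, 0, 0, 1], [], [2]]), (Plus 1, Alt, [[], [2], [0, 0, 0, 1], [], []]),
    (Plus 1, Alt, [[], [2], [0, 0, 0, 1], [], [1]]),
    (Plus 1, Alt, [[], [3, 0, 0, 0, 0, 0, 1], [0, 0, 0, 1], [], []]),
    (Plus 1, Alt, [[], [1, 0, 0, 0, 1], [0, 0, 0, 1], [1, 0, 0, 0, 1], []]),
    (Plus 1, Alt, [[], [], [0, 0, 0, 1], [], []]),
    (Plus 1, Alt, [[], [], [0, 0, 0, 1], [1], [2, 0, 0, 0, 0, 0, 0, 1]]),
    (Plus 1, Alt, [[], [1], [0, 0, 0, 1], [], [2, 0, 0, 0, 0, 0, 0, 1]]),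
    (Plus 1, Alt, [[], [2], [0, 0, 0, 1], [], []]), (Plus 1, Alt, [[], [2], [0, 0, 0, 1], [], [2]]),
    (Plus 1, Alt, [[], [4, 0, 2], [0, 0, 0, 1], [], [1, 0, 1]]), (Plus 1, Alt, [[], [2], [0, 0, 0, 1], [1], []]),
    (Alt, Alt, [[], [1], [], [], []]), (Alt, Alt, [[], [], [], [1], []]), (Alt, Alt, [[], [], [], [], []]),
    (Alt, Alt, [[], [1], [], [], [1]]), (Alt, Alt, [[], [2], [], [], [1]]), (Alt, Alt, [[], [], [1], [1], []]),
    (Alt, Alt, [[], [], [1], [2], []]), (Alt, Alt, [[], [], [0, 0, 0, 0, 0, 0, 0, 1], [], [0, 0, 0, 0, 0, 0, 0, 1]]),
    (Alt, Alt, [[], [1], [], [], [1]]), (Alt, Alt, [[], [1], [2, 0, 0, 0, 0, 0, 0, 1], [], []]),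
    (Alt, Alt, [[], [2], [0, 0, 0, 0, 0, 0, 0, 1], [], [3, 0, 0, 0, 0, 0, 0, 1]]),
    (Alt, Alt, [[], [], [1], [1], []]), (Alt, Alt, [[], [], [], [1], [2, 0, 0, 0, 0, 0, 0, 1]]),
    (Alt, Alt, [[], [], [3, 0, 0, 0, 0, 0, 0, 1], [2], [0, 0, 0, 0, 0, 0, 0, 1]]),
    (Alt, Alt, [[], [1, 0, 1], [0, 0, 0, 0, 0, 0, 0, 1], [1, 0, 1], [0, 0, 0, 0, 0, 0, 0, 1]])]"
  by code_simp

lemma diff_table_3:
  "diff_table 3 0 [Plus 0, Half, Alt] =
   [(Plus 0, Plus 0, [[0, 1], [0, 1], [0, 0, 0, 1], [], [0, 0, 0, 0, 0, 1]]),
    (Plus 0, Plus 0, [[1], [], [0, 0, 0, 1], [1], [0, 0, 0, 0, 0, 1]]),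
    (Plus 0, Plus 0, [[], [1], [0, 0, 0, 1], [2], [0, 0, 0, 0, 0, 1]]),
    (Plus 0, Plus 0, [[], [2], [0, 0, 0, 1], [1], [0, 0, 0, 0, 0, 1]]),
    (Plus 0, Half, [[0, 1], [0, 1], [0, 0, 0, 1], [1], [0, 0, 0, 0, 0, 1]]),
    (Plus 0, Half, [[1], [], [0, 0, 0, 1], [], [0, 0, 0, 0, 0, 1]]),
    (Plus 0, Half, [[], [1], [0, 0, 0, 1], [], [0, 0, 0, 0, 0, 1]]),
    (Plus 0, Half, [[], [], [0, 0, 0, 1], [2], [0, 0, 0, 0, 0, 1]]),
    (Plus 0, Half, [[1], [1], [0, 0, 0, 1], [], [0, 0, 0, 0, 0, 1]]),
    (Plus 0, Half, [[2], [3], [0, 0, 0, 1], [2], [0, 0, 0, 0, 0, 1]]),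
    (Plus 0, Alt, [[2], [2], [0, 0, 0, 1], [], []]), (Half, Plus 0, [[], [1], [0, 0, 0, 1], [], [0, 0, 0, 0, 0, 1]]),
    (Half, Plus 0, [[0, 1], [0, 1], [0, 0, 0, 1], [1], [0, 0, 0, 0, 0, 1]]),
    (Half, Plus 0, [[1], [], [0, 0, 0, 1], [], [0, 0, 0, 0, 0, 1]]),
    (Half, Plus 0, [[], [2], [0, 0, 0, 1], [], [0, 0, 0, 0, 0, 1]]),
    (Half, Half, [[0, 0, 0, 0, 0, 0, 1], [], [0, 0, 0, 1], [], [0, 0, 0, 0, 0, 1]]),
    (Half, Half, [[], [1, 0, 1], [0, 0, 0, 1], [1, 0, 1], [0, 0, 0, 0, 0, 1]]),
    (Half, Half, [[0, 1], [0, 1], [0, 0, 0, 1], [], [0, 0, 0, 0, 0, 1]]),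
    (Half, Half, [[1], [], [0, 0, 0, 1], [1], [0, 0, 0, 0, 0, 1]]),
    (Half, Half, [[], [1], [0, 0, 0, 1], [2], [0, 0, 0, 0, 0, 1]]),
    (Half, Half, [[], [2], [0, 0, 0, 1], [1], [0, 0, 0, 0, 0, 1]]),
    (Alt, Plus 0, [[1], [], [1], [1], [0, 0, 0, 0, 0, 1]]),
    (Alt, Plus 0, [[3, 0, 0, 2], [], [0, 0, 0, 1], [], [0, 0, 0, 0, 0, 1]]),
    (Alt, Half, [[1, 0, 0, 0, 0, 0, 1], [0, 0, 0, 0, 0, 0, 1], [], [], [0, 0, 0, 0, 0, 1]]),
    (Alt, Half, [[3, 0, 0, 2], [], [0, 0, 0, 1], [1], [0, 0, 0, 0, 0, 1]]),
    (Alt, Alt, [[1, 0, 0, 0, 0, 0, 1], [0, 0, 0, 0, 0, 0, 1], [0, 0, 0, 0, 0, 1], [0, 0, 0, 0, 0, 0, 1], [0, 0, 0, 0, 0, 1]]),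
    (Alt, Alt, [[1, 0, 0, 0, 1], [0, 0, 0, 0, 1], [1, 0, 0, 0, 1, 0, 1], [0, 0, 0, 0, 1], [0, 0, 0, 0, 0, 0, 1]]),
    (Alt, Alt, [[], [], [0, 0, 0, 0, 0, 1], [], [0, 0, 0, 0, 0, 1]])]"
  by code_simp

lemma sum_table_3:
  "sum_table 3 [Plus 0, Half, Alt] =
   [(Plus 0, Plus 0, [[], [], [0, 0, 0, 1], [1], [0, 0, 0, 0, 0, 1]]),
    (Plus 0, Plus 0, [[], [], [0, 0, 0, 1], [2, 0, 0, 0, 1], [0, 0, 0, 0, 0, 1]]),
    (Plus 0, Plus 0, [[], [1], [0, 0, 0, 1], [], [0, 0, 0, 0, 0, 1]]),
    (Plus 0, Plus 0, [[], [2, 0, 1], [0, 0, 0, 1], [], [0, 0, 0, 0, 0, 1]]),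
    (Plus 0, Plus 0, [[], [], [0, 0, 0, 1], [1], [0, 0, 0, 0, 0, 1]]),
    (Plus 0, Plus 0, [[], [1], [0, 0, 0, 1], [], [0, 0, 0, 0, 0, 1]]),
    (Plus 0, Half, [[], [1], [0, 0, 0, 1], [1], [0, 0, 0, 0, 0, 1]]),
    (Plus 0, Half, [[], [1], [0, 0, 0, 1], [3], [0, 0, 0, 0, 0, 1]]),
    (Plus 0, Half, [[], [2, 0, 1], [0, 0, 0, 1], [1], [0, 0, 0, 0, 0, 1]]),
    (Plus 0, Half, [[], [], [0, 0, 0, 1], [], [0, 0, 0, 0, 0, 1]]),
    (Plus 0, Half, [[], [1], [0, 0, 0, 1], [1], [0, 0, 0, 0, 0, 1]]),
    (Plus 0, Half, [[], [1], [0, 0, 0, 1], [2], [0, 0, 0, 0, 0, 1]]),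
    (Plus 0, Half, [[], [1], [0, 0, 0, 1], [3, 0, 0, 0, 1], [0, 0, 0, 0, 0, 1]]),
    (Plus 0, Half, [[], [2, 0, 0, 0, 1], [0, 0, 0, 1], [2, 0, 0, 0, 1], [0, 0, 0, 0, 0, 1]]),
    (Plus 0, Alt, [[], [], [0, 0, 0, 1], [], []]),
    (Plus 0, Alt, [[], [], [0, 0, 0, 1], [], [1, 0, 0, 0, 0, 0, 0, 1]]),
    (Half, Half, [[], [], [0, 0, 0, 1], [2], [0, 0, 0, 0, 0, 1]]),
    (Half, Half, [[], [2], [0, 0, 0, 1], [], [0, 0, 0, 0, 0, 1]]),
    (Half, Half, [[], [], [0, 0, 0, 1], [1], [0, 0, 0, 0, 0, 1]]),
    (Half, Half, [[], [], [0, 0, 0, 1], [2, 0, 0, 0, 1], [0, 0, 0, 0, 0, 1]]),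
    (Half, Half, [[], [1], [0, 0, 0, 1], [], [0, 0, 0, 0, 0, 1]]),
    (Half, Half, [[], [2, 0, 1], [0, 0, 0, 1], [], [0, 0, 0, 0, 0, 1]]),
    (Half, Alt, [[], [2], [0, 0, 0, 1], [], []]), (Half, Alt, [[], [1], [0, 0, 0, 1], [], []]),
    (Half, Alt, [[], [1], [0, 0, 0, 1], [], [1, 0, 0, 0, 0, 0, 0, 1]]),
    (Half, Alt, [[], [3, 0, 0, 0, 0, 0, 0, 2], [0, 0, 0, 1], [], [0, 0, 0, 0, 0, 0, 0, 1]])]"
  by code_simp

lemma diff_table_5:
  "diff_table 5 0 [Plus 0, Half, Alt, Const 7] =
   [(Plus 0, Half, [[], [], [0, 0, 0, 1], [], [0, 0, 0, 0, 0, 1]]),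
    (Plus 0, Half, [[1], [1], [0, 0, 0, 1], [1], [0, 0, 0, 0, 0, 1]]),
    (Plus 0, Half, [[1], [], [0, 0, 0, 1], [], [0, 0, 0, 0, 0, 1]]),
    (Plus 0, Half, [[], [1], [0, 0, 0, 1], [], [0, 0, 0, 0, 0, 1]]),
    (Plus 0, Const 7, [[], [1], [0, 0, 0, 1], [0, 0, 0, 0, 1], [0, 0, 0, 0, 0, 1]]),
    (Half, Plus 0, [[0, 1], [0, 1], [0, 0, 0, 1], [], [0, 0, 0, 0, 0, 1]]),
    (Half, Plus 0, [[], [], [0, 0, 0, 1], [1], [0, 0, 0, 0, 0, 1]]),
    (Half, Half, [[0, 0, 0, 0, 0, 0, 1], [], [0, 0, 0, 1], [], [0, 0, 0, 0, 0, 1]]),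
    (Half, Half, [[], [1, 0, 1], [0, 0, 0, 1], [1, 0, 1], [0, 0, 0, 0, 0, 1]]),
    (Alt, Half, [[1, 0, 0, 0, 0, 0, 1], [0, 0, 0, 0, 0, 0, 1], [], [], [0, 0, 0, 0, 0, 1]]),
    (Alt, Alt, [[1, 0, 0, 0, 0, 0, 1], [0, 0, 0, 0, 0, 0, 1], [0, 0, 0, 0, 0, 1], [0, 0, 0, 0, 0, 0, 1], [0, 0, 0, 0, 0, 1]]),
    (Alt, Alt, [[1, 0, 0, 0, 1], [0, 0, 0, 0, 1], [1, 0, 0, 0, 1, 0, 1], [0, 0, 0, 0, 1], [0, 0, 0, 0, 0, 0, 1]]),
    (Const 7, Plus 0, [[], [0, 0, 1], [0, 0, 0, 1], [1], [0, 0, 0, 0, 0, 1]])]"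
  by code_simp

text \<open>The prime-to-5 parts are 1/2, 1 or 2 modulo 5, and among their sums only 2 + 1/2 is 0.
  So one summand is 2 or 7, the other a \<open>Half\<close> with positive exponent.\<close>

lemma sum_table_5:
  "sum_table 5 [Plus 0, Half, Alt, Const 7] =
   [(Plus 0, Half, [[], [], [0, 0, 0, 1], [1], [0, 0, 0, 0, 0, 1]]),
    (Plus 0, Half, [[], [], [0, 0, 0, 1], [2, 0, 0, 0, 1], [0, 0, 0, 0, 0, 1]]),
    (Half, Const 7, [[], [1], [0, 0, 0, 1], [0, 0, 0, 0, 1], [0, 0, 0, 0, 0, 1]])]"
  by code_simp

lemma diff_table_7:
  "diff_table 7 0 [Plus 0, Half, Alt] =
   [(Plus 0, Plus 0, [[], [], [0, 0, 0, 1], [], [0, 0, 0, 0, 0, 1]]),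
    (Half, Half, [[0, 0, 0, 0, 0, 0, 1], [], [0, 0, 0, 1], [], [0, 0, 0, 0, 0, 1]]),
    (Half, Half, [[], [1, 0, 1], [0, 0, 0, 1], [1, 0, 1], [0, 0, 0, 0, 0, 1]]),
    (Alt, Half, [[1, 0, 0, 0, 0, 0, 1], [0, 0, 0, 0, 0, 0, 1], [], [], [0, 0, 0, 0, 0, 1]]),
    (Alt, Alt, [[1, 0, 0, 0, 0, 0, 1], [0, 0, 0, 0, 0, 0, 1], [0, 0, 0, 0, 0, 1], [0, 0, 0, 0, 0, 0, 1], [0, 0, 0, 0, 0, 1]]),
    (Alt, Alt, [[1, 0, 0, 0, 1], [0, 0, 0, 0, 1], [1, 0, 0, 0, 1, 0, 1], [0, 0, 0, 0, 1], [0, 0, 0, 0, 0, 0, 1]])]"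
  by code_simp

text \<open>For \<open>p > 5\<close> the residues 1/2, 1 and 2 have the sums 1, 3/2, 2, 5/2, 3 and
  4, none of which is 0 modulo \<open>p\<close>, so \<open>A + B\<close> is never divisible by
  \<open>p\<close>.\<close>

lemma sum_table_7:
  "sum_table 7 [Plus 0, Half, Alt] =
   []"
  by code_simp

text \<open>These entries are the families (1), (2) and (3) of the list; they recur in the tables
  for 3, 5 and 7.\<close>

lemma diff_table_large:
  "diff_table 0 0 [Plus 0, Half, Alt] =
   [(Half, Half, [[0, 0, 0, 0, 0, 0, 1], [], [0, 0, 0, 1], [], [0, 0, 0, 0, 0, 1]]),
    (Half, Half, [[], [1, 0, 1], [0, 0, 0, 1], [1, 0, 1], [0, 0, 0, 0, 0, 1]]),
    (Alt, Half, [[1, 0, 0, 0, 0, 0, 1], [0, 0, 0, 0, 0, 0, 1], [], [], [0, 0, 0, 0, 0, 1]]),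
    (Alt, Alt, [[1, 0, 0, 0, 0, 0, 1], [0, 0, 0, 0, 0, 0, 1], [0, 0, 0, 0, 0, 1], [0, 0, 0, 0, 0, 0, 1], [0, 0, 0, 0, 0, 1]]),
    (Alt, Alt, [[1, 0, 0, 0, 1], [0, 0, 0, 0, 1], [1, 0, 0, 0, 1, 0, 1], [0, 0, 0, 0, 1], [0, 0, 0, 0, 0, 0, 1]])]"
  by code_simp

lemma sum_table_large:
  "sum_table 0 [Plus 0, Half, Alt] =
   []"
  by code_simp

section \<open>Matching the solutions with the list\<close>

text \<open>The lemma \<open>listed_k\<close> is item (k) of the list.\<close>

lemma div_eqI: "d * A = n \<Longrightarrow> 0 < d \<Longrightarrow> A = n div d" for d A n :: nat
  by auto

lemma listed_1:
  assumes "b \<ge> 1" "odd c" "(p ^ b + 1) * A = p ^ (b * c) + 1"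
  shows "listed_pair p A (p ^ b * A)"
proof -
  have "odd_multiple (c * b) b" using assms(2) by (auto simp: odd_multiple_def Suc_le_eq odd_pos)
  moreover have "A = (p ^ (c * b) + 1) div (p ^ b + 1)"
    using assms(3) by (intro div_eqI) (auto simp: mult.commute)
  ultimately have "\<exists>a b'. b' \<ge> 1 \<and> odd_multiple a b' \<and>
        A = (p^a + 1) div (p^b' + 1) \<and> p ^ b * A = p^b' * ((p^a + 1) div (p^b' + 1))"
    using assms(1) by metis
  then show ?thesis unfolding listed_pair_def by (simp only: simp_thms)
qed

lemma listed_2:
  assumes "b \<ge> 1" "odd c" "(p ^ b + 1) * A = p ^ (b * c + 2 * b) + 1" "(p ^ b + 1) * B = p ^ (b * c) + 1"
  shows "listed_pair p A (p ^ b * B)"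
proof -
  have "odd_multiple (c * b) b" using assms(2) by (auto simp: odd_multiple_def Suc_le_eq odd_pos)
  moreover have "A = (p ^ (c * b + 2 * b) + 1) div (p ^ b + 1)" "B = (p ^ (c * b) + 1) div (p ^ b + 1)"
    using assms(3,4) by (intro div_eqI; auto simp: mult.commute)+
  ultimately have "\<exists>a b'. b' \<ge> 1 \<and> odd_multiple a b' \<and>
        A = (p^(a + 2*b') + 1) div (p^b' + 1) \<and> p ^ b * B = p^b' * ((p^a + 1) div (p^b' + 1))"
    using assms(1) by metis
  then show ?thesis unfolding listed_pair_def by (simp only: simp_thms)
qed

lemma listed_3:
  assumes "p \<ge> 3" "2 * A = p ^ a + 1" shows "listed_pair p A A"
proof -
  have "\<exists>a. A = (p^a + 1) div 2 \<and> A = (p^a + 1) div 2"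
    using assms(2) by (metis div_eqI zero_less_numeral)
  then show ?thesis using assms(1) unfolding listed_pair_def by (simp only: simp_thms)
qed

lemma listed_5:
  assumes "a \<ge> 1"
  shows "listed_pair 2 (2 ^ a + 1) (2 ^ a + 1)"
proof -
  have "\<exists>c\<ge>1. (2 ^ a + 1 :: nat) = 2^c + 1 \<and> (2 ^ a + 1 :: nat) = 2^c + 1"
    by (rule exI[of _ a]) (use assms in auto)
  then show ?thesis unfolding listed_pair_def by (simp only: simp_thms)
qed

lemma listed_6:
  assumes "b \<ge> 1" "odd c" "(2 ^ b + 1) * A = 2 ^ (b * c) + 1"
  shows "listed_pair 2 A A"
proof -
  have "A = (2 ^ (c * b) + 1) div (2 ^ b + 1)"
    using assms(3) by (intro div_eqI) (auto simp: mult.commute)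
  then have "\<exists>a b. b \<ge> 1 \<and> (\<exists>k. odd k \<and> a = k * b) \<and>
        A = (2^a + 1) div (2^b + 1) \<and> A = (2^a + 1) div (2^b + 1)"
    using assms(1,2) by metis
  then show ?thesis unfolding listed_pair_def by (simp only: simp_thms)
qed

lemma listed_7:
  assumes "a \<ge> 1"
  shows "listed_pair 2 1 (2 ^ a + 1)"
proof -
  have "\<exists>c\<ge>1. (1 :: nat) = 1 \<and> (2 ^ a + 1 :: nat) = 2^c + 1"
    by (rule exI[of _ a]) (use assms in auto)
  then show ?thesis unfolding listed_pair_def by (simp only: simp_thms)
qed

lemma listed_8:
  assumes "a \<ge> 1"
  shows "listed_pair 2 (2 ^ a + 1) (2 ^ a)"
proof -
  have "\<exists>c\<ge>1. (2 ^ a + 1 :: nat) = 2^c + 1 \<and> (2 ^ a :: nat) = 2^c"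
    by (rule exI[of _ a]) (use assms in auto)
  then show ?thesis unfolding listed_pair_def by (simp only: simp_thms)
qed

lemma listed_9:
  assumes "a \<ge> 1"
  shows "listed_pair 2 3 (2 ^ a + 1)"
proof -
  have "\<exists>c\<ge>1. (3 :: nat) = 3 \<and> (2 ^ a + 1 :: nat) = 2^c + 1"
    by (rule exI[of _ a]) (use assms in auto)
  then show ?thesis unfolding listed_pair_def by (simp only: simp_thms)
qed

lemma listed_10:
  assumes "a \<ge> 1"
  shows "listed_pair 2 (2 ^ a + 1) (3 * 2 ^ a)"
proof -
  have "\<exists>c\<ge>1. (2 ^ a + 1 :: nat) = 2^c + 1 \<and> (3 * 2 ^ a :: nat) = 3 * 2^c"
    by (rule exI[of _ a]) (use assms in auto)
  then show ?thesis unfolding listed_pair_def by (simp only: simp_thms)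
qed

lemma listed_11:
  assumes "a \<ge> 1" "(2 ^ a + 1) * B = 2 ^ (3 * a) + 1"
  shows "listed_pair 2 (2 ^ a + 1) B"
proof -
  have "\<exists>c\<ge>1. (2 ^ a + 1 :: nat) = 2^c + 1 \<and> B = (2^(3*c) + 1) div (2^c + 1)"
    by (rule exI[of _ a]) (use assms(1) div_eqI[OF assms(2)] in simp)
  then show ?thesis unfolding listed_pair_def by (simp only: simp_thms)
qed

lemma listed_12:
  assumes "a \<ge> 1" "(2 ^ a + 1) * A = 2 ^ (3 * a) + 1"
  shows "listed_pair 2 A (2 ^ a * (2 ^ a + 1))"
proof -
  have "\<exists>c\<ge>1. A = (2^(3*c) + 1) div (2^c + 1) \<and> (2 ^ a * (2 ^ a + 1) :: nat) = 2^c * (2^c + 1)"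
    by (rule exI[of _ a]) (use assms(1) div_eqI[OF assms(2)] in simp)
  then show ?thesis unfolding listed_pair_def by (simp only: simp_thms)
qed

lemma listed_13:
  assumes "odd a" "3 * B = 2 ^ a + 1"
  shows "listed_pair 2 (2 ^ a + 1) B"
proof -
  have "\<exists>c\<ge>1. odd c \<and> (2 ^ a + 1 :: nat) = 2^c + 1 \<and> B = (2^c + 1) div 3"
    by (rule exI[of _ a]) (use assms odd_pos[of a] in auto)
  then show ?thesis unfolding listed_pair_def by (simp only: simp_thms)
qed

lemma listed_14:
  assumes "odd a" "3 * B = 2 ^ a + 1"
  shows "listed_pair 2 1 B"
proof -
  have "\<exists>c\<ge>1. odd c \<and> (1 :: nat) = 1 \<and> B = (2^c + 1) div 3"
    by (rule exI[of _ a]) (use assms odd_pos[of a] in auto)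
  then show ?thesis unfolding listed_pair_def by (simp only: simp_thms)
qed

lemma listed_15:
  assumes "odd a" "3 * A = 2 ^ a + 1"
  shows "listed_pair 2 A (2 ^ a)"
proof -
  have "\<exists>c\<ge>1. odd c \<and> A = (2^c + 1) div 3 \<and> (2 ^ a :: nat) = 2^c"
    by (rule exI[of _ a]) (use assms odd_pos[of a] in auto)
  then show ?thesis unfolding listed_pair_def by (simp only: simp_thms)
qed

lemma listed_16:
  assumes "odd a" "5 * B = 2 ^ (2 * a) + 1"
  shows "listed_pair 2 3 B"
proof -
  have "\<exists>c\<ge>1. odd c \<and> (3 :: nat) = 3 \<and> B = (2^(2*c) + 1) div 5"
    by (rule exI[of _ a]) (use assms odd_pos[of a] in auto)
  then show ?thesis unfolding listed_pair_def by (simp only: simp_thms)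
qed

lemma listed_17:
  assumes "odd a" "5 * A = 2 ^ (2 * a) + 1"
  shows "listed_pair 2 A (3 * 2 ^ (2 * a))"
proof -
  have "\<exists>c\<ge>1. odd c \<and> A = (2^(2*c) + 1) div 5 \<and> (3 * 2 ^ (2 * a) :: nat) = 3 * 2^(2*c)"
    by (rule exI[of _ a]) (use assms odd_pos[of a] in auto)
  then show ?thesis unfolding listed_pair_def by (simp only: simp_thms)
qed

lemma listed_18:
  assumes "odd a" "3 * B = 2 ^ a + 1"
  shows "listed_pair 2 5 B"
proof -
  have "\<exists>c\<ge>1. odd c \<and> (5 :: nat) = 5 \<and> B = (2^c + 1) div 3"
    by (rule exI[of _ a]) (use assms odd_pos[of a] in auto)
  then show ?thesis unfolding listed_pair_def by (simp only: simp_thms)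
qed

lemma listed_19:
  assumes "odd a" "3 * A = 2 ^ a + 1"
  shows "listed_pair 2 A (5 * 2 ^ a)"
proof -
  have "\<exists>c\<ge>1. odd c \<and> A = (2^c + 1) div 3 \<and> (5 * 2 ^ a :: nat) = 5 * 2^c"
    by (rule exI[of _ a]) (use assms odd_pos[of a] in auto)
  then show ?thesis unfolding listed_pair_def by (simp only: simp_thms)
qed

lemma listed_20:
  assumes "odd a" "9 * A = 2 ^ (3 * a) + 1" "3 * B = 2 ^ (3 * a) + 1"
  shows "listed_pair 2 A B"
proof -
  have "\<exists>c\<ge>1. odd c \<and> A = (2^(3*c) + 1) div 9 \<and> B = (2^(3*c) + 1) div 3"
    by (rule exI[of _ a]) (use assms odd_pos[of a] in auto)
  then show ?thesis unfolding listed_pair_def by (simp only: simp_thms)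
qed

lemma listed_21:
  assumes "odd a" "9 * A = 2 ^ (3 * a) + 1"
  shows "listed_pair 2 A (2 * A)"
proof -
  have "\<exists>c\<ge>1. odd c \<and> A = (2^(3*c) + 1) div 9 \<and> (2 * A :: nat) = 2 * ((2^(3*c) + 1) div 9)"
    by (rule exI[of _ a]) (use assms odd_pos[of a] in auto)
  then show ?thesis unfolding listed_pair_def by (simp only: simp_thms)
qed

lemma listed_23:
  shows "listed_pair 3 2 (3 ^ a + 1)"
proof -
  have "\<exists>c. (2 :: nat) = 2 \<and> (3 ^ a + 1 :: nat) = 3^c + 1"
    by (rule exI[of _ a]) simp
  then show ?thesis unfolding listed_pair_def by (simp only: simp_thms)
qed

lemma listed_24:
  shows "listed_pair 3 (3 ^ a + 1) (2 * 3 ^ a)"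
proof -
  have "\<exists>c. (3 ^ a + 1 :: nat) = 3^c + 1 \<and> (2 * 3 ^ a :: nat) = 2 * 3^c"
    by (rule exI[of _ a]) simp
  then show ?thesis unfolding listed_pair_def by (simp only: simp_thms)
qed

lemma listed_25:
  assumes "2 * B = 3 ^ a + 1"
  shows "listed_pair 3 (3 ^ a + 1) B"
proof -
  have "\<exists>c. (3 ^ a + 1 :: nat) = 3^c + 1 \<and> B = (3^c + 1) div 2"
    by (rule exI[of _ a]) (use assms in auto)
  then show ?thesis unfolding listed_pair_def by (simp only: simp_thms)
qed

lemma listed_26:
  assumes "2 * B = 3 ^ a + 1"
  shows "listed_pair 3 1 B"
proof -
  have "\<exists>c. (1 :: nat) = 1 \<and> B = (3^c + 1) div 2"
    by (rule exI[of _ a]) (use assms in auto)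
  then show ?thesis unfolding listed_pair_def by (simp only: simp_thms)
qed

lemma listed_27:
  assumes "2 * A = 3 ^ a + 1"
  shows "listed_pair 3 A (3 ^ a)"
proof -
  have "\<exists>c. A = (3^c + 1) div 2 \<and> (3 ^ a :: nat) = 3^c"
    by (rule exI[of _ a]) (use assms in auto)
  then show ?thesis unfolding listed_pair_def by (simp only: simp_thms)
qed

lemma listed_28:
  assumes "2 * B = 3 ^ a + 1"
  shows "listed_pair 3 4 B"
proof -
  have "\<exists>c. (4 :: nat) = 4 \<and> B = (3^c + 1) div 2"
    by (rule exI[of _ a]) (use assms in auto)
  then show ?thesis unfolding listed_pair_def by (simp only: simp_thms)
qed

lemma listed_29:
  assumes "2 * A = 3 ^ a + 1"
  shows "listed_pair 3 A (4 * 3 ^ a)"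
proof -
  have "\<exists>c. A = (3^c + 1) div 2 \<and> (4 * 3 ^ a :: nat) = 4 * 3^c"
    by (rule exI[of _ a]) (use assms in auto)
  then show ?thesis unfolding listed_pair_def by (simp only: simp_thms)
qed

lemma listed_30:
  assumes "odd a" "2 * A = 3 ^ a + 1" "4 * B = 3 ^ a + 1"
  shows "listed_pair 3 A B"
proof -
  have "\<exists>c\<ge>1. odd c \<and> A = (3^c + 1) div 2 \<and> B = (3^c + 1) div 4"
    by (rule exI[of _ a]) (use assms odd_pos[of a] in auto)
  then show ?thesis unfolding listed_pair_def by (simp only: simp_thms)
qed

lemma listed_31:
  assumes "odd a" "4 * A = 3 ^ a + 1"
  shows "listed_pair 3 A A"
proof -
  have "\<exists>c\<ge>1. odd c \<and> A = (3^c + 1) div 4 \<and> A = (3^c + 1) div 4"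
    by (rule exI[of _ a]) (use assms odd_pos[of a] in auto)
  then show ?thesis unfolding listed_pair_def by (simp only: simp_thms)
qed

lemma listed_32:
  assumes "odd a" "4 * B = 3 ^ a + 1"
  shows "listed_pair 3 2 B"
proof -
  have "\<exists>c\<ge>1. odd c \<and> (2 :: nat) = 2 \<and> B = (3^c + 1) div 4"
    by (rule exI[of _ a]) (use assms odd_pos[of a] in auto)
  then show ?thesis unfolding listed_pair_def by (simp only: simp_thms)
qed

lemma listed_33:
  assumes "odd a" "4 * A = 3 ^ a + 1"
  shows "listed_pair 3 A (2 * 3 ^ a)"
proof -
  have "\<exists>c\<ge>1. odd c \<and> A = (3^c + 1) div 4 \<and> (2 * 3 ^ a :: nat) = 2 * 3^c"
    by (rule exI[of _ a]) (use assms odd_pos[of a] in auto)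
  then show ?thesis unfolding listed_pair_def by (simp only: simp_thms)
qed

lemma listed_35:
  assumes "2 * B = 5 ^ a + 1"
  shows "listed_pair 5 2 B"
proof -
  have "\<exists>c. (2 :: nat) = 2 \<and> B = (5^c + 1) div 2"
    by (rule exI[of _ a]) (use assms in auto)
  then show ?thesis unfolding listed_pair_def by (simp only: simp_thms)
qed

lemma listed_36:
  assumes "2 * A = 5 ^ a + 1"
  shows "listed_pair 5 A (2 * 5 ^ a)"
proof -
  have "\<exists>c. A = (5^c + 1) div 2 \<and> (2 * 5 ^ a :: nat) = 2 * 5^c"
    by (rule exI[of _ a]) (use assms in auto)
  then show ?thesis unfolding listed_pair_def by (simp only: simp_thms)
qed

section \<open>Quotients of form (iii) and the families that they yield\<close>

lemma represents_unique:
  assumes "represents p s u w A" "represents p s u w B" shows "A = B"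
proof (cases s)
  case Alt
  then have "(p ^ Suc u + 1) * A = (p ^ Suc u + 1) * B"
    using assms by (metis represents.simps(4))
  then show ?thesis by (metis mult_cancel1 add_is_0 one_neq_zero)
qed (use assms in auto)

text \<open>Recovers the odd multiplier \<open>3 + 2 * m\<close>, hidden from the solver by the free
  variable \<open>w\<close>.\<close>

lemma represents_Alt:
  assumes "represents p Alt u w A"
  obtains m where "w = Suc u * m" "(p ^ Suc u + 1) * A = p ^ (Suc u * (3 + 2 * m)) + 1"
proof -
  obtain m where m: "w = Suc u * m" "(p ^ Suc u + 1) * A = p ^ (3 + 3 * u + 2 * w) + 1"
    using assms by auto
  have "3 + 3 * u + 2 * w = Suc u * (3 + 2 * m)" by (simp add: m(1) algebra_simps)
  with m that show thesis by metis
qed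

lemma represents_1:
  assumes "represents p Alt u w A" "represents p Alt u w B"
  shows "listed_pair p A (p ^ Suc u * B)"
proof -
  obtain m where "(p ^ Suc u + 1) * A = p ^ (Suc u * (3 + 2 * m)) + 1"
    using assms(1) by (rule represents_Alt)
  from listed_1[OF _ _ this] show ?thesis using represents_unique[OF assms] by simp
qed

text \<open>Both \<open>w\<close> and \<open>1 + u + w\<close> are multiples of
  \<open>Suc u\<close>, so the multipliers \<open>m\<close> and \<open>n\<close> are consecutive and
  the exponents differ by exactly \<open>2 * Suc u\<close>.\<close>

lemma represents_2:
  assumes "represents p Alt u (1 + u + w) A" "represents p Alt u w B"
  shows "listed_pair p A (p ^ Suc u * B)"
proof -
  obtain m where m: "w = Suc u * m" "(p ^ Suc u + 1) * B = p ^ (Suc u * (3 + 2 * m)) + 1"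
    using assms(2) by (rule represents_Alt)
  obtain n where n: "1 + u + w = Suc u * n" "(p ^ Suc u + 1) * A = p ^ (Suc u * (3 + 2 * n)) + 1"
    using assms(1) by (rule represents_Alt)
  have "Suc u * n = Suc u * Suc m" using m(1) n(1) by simp
  then have "n = Suc m" by (simp only: mult_cancel1) simp
  then have eq: "Suc u * (3 + 2 * n) = Suc u * (3 + 2 * m) + 2 * Suc u" by (simp add: algebra_simps)
  show ?thesis by (rule listed_2[OF _ _ n(2)[unfolded eq] m(2)]) simp_all
qed

text \<open>The companion of \<open>represents_2\<close> with cofactor 1, which is no
  \<open>Alt\<close> because multipliers there start at 3. Here \<open>w = 0\<close> means
  multiplier 3, hence item (2) with \<open>a = b\<close>.\<close>

lemma represents_2_one:
  assumes "represents p Alt u 0 A"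
  shows "listed_pair p A (p ^ Suc u)"
proof -
  obtain m where m: "0 = Suc u * m" "(p ^ Suc u + 1) * A = p ^ (Suc u * (3 + 2 * m)) + 1"
    using assms by (rule represents_Alt)
  have eq: "Suc u * (3 + 2 * m) = Suc u * 1 + 2 * Suc u" using m(1) by simp
  from listed_2[OF _ _ m(2)[unfolded eq], of 1] show ?thesis by simp
qed

lemma represents_6:
  assumes "represents 2 Alt u w A" "represents 2 Alt u w B"
  shows "listed_pair 2 A B"
proof -
  obtain m where "(2 ^ Suc u + 1) * A = 2 ^ (Suc u * (3 + 2 * m)) + 1"
    using assms(1) by (rule represents_Alt)
  from listed_6[OF _ _ this] show ?thesis using represents_unique[OF assms] by simp
qed

lemma represents_16:
  assumes "represents 2 Alt 1 w B" shows "listed_pair 2 3 B"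
proof -
  obtain m where "(2 ^ Suc 1 + 1) * B = 2 ^ (Suc 1 * (3 + 2 * m)) + 1"
    using assms by (rule represents_Alt)
  then show ?thesis by (intro listed_16[of "3 + 2 * m"]) simp_all
qed

lemma represents_17:
  assumes "represents 2 Alt 1 w A" shows "listed_pair 2 A (2 ^ (6 + 2 * w) * 3)"
proof -
  obtain m where m: "w = Suc 1 * m" "(2 ^ Suc 1 + 1) * A = 2 ^ (Suc 1 * (3 + 2 * m)) + 1"
    using assms by (rule represents_Alt)
  have "6 + 2 * w = 2 * (3 + 2 * m)" by (simp add: m(1))
  moreover have "listed_pair 2 A (3 * 2 ^ (2 * (3 + 2 * m)))"
    using m(2) by (intro listed_17) simp_all
  ultimately show ?thesis by (simp only: mult.commute)
qed

text \<open>\<open>B\<close> has denominator 3 and exponent \<open>9 + 2 * w\<close>; that this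
  exponent is 3 times an odd number is known only through \<open>w = 3 * m\<close>, which comes from
  \<open>A\<close>.\<close>

lemma represents_20:
  assumes "represents 2 Alt 2 w A" "represents 2 Alt 0 (3 + w) B"
  shows "listed_pair 2 A B"
proof -
  obtain m where m: "w = Suc 2 * m" "(2 ^ Suc 2 + 1) * A = 2 ^ (Suc 2 * (3 + 2 * m)) + 1"
    using assms(1) by (rule represents_Alt)
  have "3 * B = 2 ^ (3 + 2 * (3 + w)) + 1" using assms(2) by simp
  moreover have "3 + 2 * (3 + w) = 3 * (3 + 2 * m)" using m(1) by simp
  ultimately show ?thesis using m(2) by (intro listed_20[of "3 + 2 * m"]) simp_all
qed

lemma represents_21:
  assumes "represents 2 Alt 2 w A" "represents 2 Alt 2 w B" shows "listed_pair 2 A (2 * B)"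
proof -
  obtain m where "(2 ^ Suc 2 + 1) * A = 2 ^ (Suc 2 * (3 + 2 * m)) + 1"
    using assms(1) by (rule represents_Alt)
  then have "listed_pair 2 A (2 * A)" by (intro listed_21[of "3 + 2 * m"]) simp_all
  then show ?thesis using represents_unique[OF assms] by simp
qed

section \<open>Sporadic pairs and small members of the families\<close>

lemma listed_4:
  "(A, B) \<in> {(3,10),(5,6),(5,8),(5,17),(5,52),(9,2),(9,4),(9,11),(9,13),(9,17),
     (9,34),(9,43),(9,48),(11,2),(11,13),(11,57),(13,44),(13,228),(17,26),(17,40),(33,10),
     (33,24),(33,172),(33,208),(65,176),(171,34),(205,36)} \<Longrightarrow> listed_pair 2 A B"
  unfolding listed_pair_def by (simp only: simp_thms)

lemma listed_22:
  "(A, B) \<in> {(2,5),(4,3),(4,10),(5,7),(10,63),(28,45),(61,12)} \<Longrightarrow> listed_pair 3 A B"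
  unfolding listed_pair_def by (simp only: simp_thms)

lemma listed_34: "(A, B) \<in> {(1,6),(2,5),(3,7),(6,7),(6,15)} \<Longrightarrow> listed_pair 5 A B"
  unfolding listed_pair_def by (simp only: simp_thms)

lemma listed_37: "listed_pair 7 2 2"
  unfolding listed_pair_def by (simp only: simp_thms)

text \<open>Table entries without free exponents that belong to the infinite families rather than to
  the sporadic list.\<close>

lemma listed_small_2:
  "listed_pair 2 1 1" "listed_pair 2 1 2" "listed_pair 2 1 10" "listed_pair 2 1 12" "listed_pair 2 3 6"
  "listed_pair 2 3 8" "listed_pair 2 3 40" "listed_pair 2 11 6" "listed_pair 2 1 3" "listed_pair 2 1 5"
  "listed_pair 2 1 11" "listed_pair 2 3 3" "listed_pair 2 3 5" "listed_pair 2 3 9" "listed_pair 2 3 13"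
  "listed_pair 2 5 11" "listed_pair 2 5 43"
  using listed_6[of 1 1 1] listed_15[of 1 1] listed_19[of 1 1] listed_17[of 1 1] listed_10[of 1]
    listed_15[of 3 3] listed_19[of 3 3] listed_2[of 1 3 2 11 3] listed_7[of 1] listed_7[of 2]
    listed_14[of 5 11] listed_5[of 1] listed_9[of 2] listed_9[of 3] listed_16[of 3 13]
    listed_18[of 5 11] listed_18[of 7 43]
  by simp_all

lemma listed_small_3:
  "listed_pair 3 1 6" "listed_pair 3 2 2" "listed_pair 3 2 3" "listed_pair 3 2 12" "listed_pair 3 4 1"
  "listed_pair 3 1 2" "listed_pair 3 1 5" "listed_pair 3 2 4" "listed_pair 3 2 7" "listed_pair 3 4 5"
  "listed_pair 3 4 14"
  using listed_33[of 1 1] listed_3[of 3 2 1] listed_27[of 2 1] listed_29[of 2 1] listed_28[of 1 0]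
    listed_26[of 2 1] listed_26[of 5 2] listed_23[of 1] listed_32[of 3 7] listed_28[of 5 2] listed_28[of 14 3]
  by simp_all

lemma listed_small_5: "listed_pair 5 2 1" "listed_pair 5 2 3"
  using listed_35[of 1 0] listed_35[of 3 1] by simp_all

lemma entry_listedI:
  "(\<And>y A B. y 0 = 1 \<Longrightarrow> represents p s1 (dot (r ! 1) y) (dot (r ! 2) y) A \<Longrightarrow>
     represents p s2 (dot (r ! 3) y) (dot (r ! 4) y) B \<Longrightarrow>
     listed_pair p A (p ^ (d + dot (r ! 0) y) * B) \<or> listed_pair p (p ^ (d + dot (r ! 0) y) * B) A) \<Longrightarrow>
   entry_listed p d (s1, s2, r)"
  by (auto simp: entry_listed_def)

text \<open>Below, the entries with constant exponents are discharged first; the remaining subgoals are the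
  families of table entries with free exponents \<open>y i\<close>.\<close>

lemma entries_listed_large:
  assumes "p \<ge> 3"
  shows "list_all (entry_listed p 0) (diff_table 0 0 [Plus 0, Half, Alt])"
  unfolding diff_table_large
  apply (simp only: list.pred_inject simp_thms; intro conjI entry_listedI)
  \<comment> \<open>The pair is \<open>(1, p ^ k)\<close>, item (1) with \<open>a = b = k\<close>.
    That item asks for \<open>b\<close> to be positive, so \<open>(1, 1)\<close> goes to item (3)
    with \<open>a = 0\<close>.\<close>
  subgoal for y A B using assms listed_1[of "y 6" 1 p 1] listed_3[of p 1 0]
    by (cases "y 6 = 0") (auto simp: power_add mult_ac One_nat_def[symmetric] simp del: One_nat_def)
  subgoal for y A B using assms listed_3[of p A "y 2 + 1"]
    by (cases "A = B") (auto simp: One_nat_def[symmetric] simp del: One_nat_def)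
  subgoal for y A B using represents_2_one[of p "y 6" A]
    by (auto simp: power_add mult_ac One_nat_def[symmetric] simp del: One_nat_def)
  subgoal for y A B using represents_1[of p "y 6" "y 5" A B]
    by (auto simp: power_add ac_simps One_nat_def[symmetric] simp del: One_nat_def represents.simps)
  subgoal for y A B using represents_2[of p "y 4" "y 6" A B]
    by (auto simp: power_add ac_simps One_nat_def[symmetric] simp del: One_nat_def represents.simps)
  done

lemma entries_listed_diff_2: "list_all (entry_listed 2 1) (diff_table 2 1 [Const 1, Plus 1, Alt])"
  unfolding diff_table_2
  apply (simp only: list.pred_inject simp_thms)
  apply (intro conjI entry_listedI;
    (auto simp: listed_4 listed_small_2 One_nat_def[symmetric] simp del: One_nat_def; fail)?)
  subgoal for y A B using listed_1[of "y 6 + 1" 1 2 1]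
    by (auto simp: power_add mult_ac One_nat_def[symmetric] simp del: One_nat_def)
  subgoal for y A B using listed_8[of "y 1 + 1"]
    by (auto simp: power_add mult_ac One_nat_def[symmetric] simp del: One_nat_def)
  subgoal for y A B using listed_10[of "y 1 + 1"]
    by (auto simp: power_add mult_ac One_nat_def[symmetric] simp del: One_nat_def)
  subgoal for y A B using listed_10[of "y 1 + 1"]
    by (auto simp: power_add mult_ac One_nat_def[symmetric] simp del: One_nat_def)
  subgoal for y A B using represents_2_one[of 2 "y 6" A]
    by (auto simp: power_add mult_ac One_nat_def[symmetric] simp del: One_nat_def)
  subgoal for y A B using listed_15[of "3 + 2 * y 3" A]
    by (auto simp: power_add mult_ac One_nat_def[symmetric] simp del: One_nat_def)
  subgoal for y A B using listed_12[of "y 2 + 2" A]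
    by (auto simp: power_add mult_ac One_nat_def[symmetric] simp del: One_nat_def)
  subgoal for y A B using listed_19[of "3 + 2 * y 3" A]
    by (auto simp: power_add mult_ac One_nat_def[symmetric] simp del: One_nat_def)
  subgoal for y A B using represents_17[of "y 3" A]
    by (auto simp: power_add mult_ac One_nat_def[symmetric] simp del: One_nat_def)
  subgoal for y A B using represents_1[of 2 "y 6" "y 5" A B]
    by (auto simp: power_add ac_simps One_nat_def[symmetric] simp del: One_nat_def represents.simps)
  subgoal for y A B using represents_2[of 2 "y 4" "y 6" A B]
    by (auto simp: power_add ac_simps One_nat_def[symmetric] simp del: One_nat_def represents.simps)
  subgoal for y A B using represents_21[of "y 5" A B]
    by (auto simp: power_add mult_ac One_nat_def[symmetric] simp del: One_nat_def)
  subgoal for y A B using represents_17[of "y 3" A]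
    by (auto simp: power_add mult_ac One_nat_def[symmetric] simp del: One_nat_def)
  done

lemma entries_listed_sum_2: "list_all (entry_listed 2 0) (sum_table 2 [Const 1, Plus 1, Alt])"
  unfolding sum_table_2
  apply (simp only: list.pred_inject simp_thms)
  apply (intro conjI entry_listedI;
    (auto simp: listed_4 listed_small_2 One_nat_def[symmetric] simp del: One_nat_def; fail)?)
  subgoal for y A B using listed_7[of "y 6 + 2"]
    by (auto simp: power_add mult_ac One_nat_def[symmetric] simp del: One_nat_def)
  subgoal for y A B using listed_14[of "5 + 2 * y 7" B]
    by (auto simp: power_add mult_ac One_nat_def[symmetric] simp del: One_nat_def)
  subgoal for y A B using listed_9[of "y 6 + 3"]
    by (auto simp: power_add mult_ac One_nat_def[symmetric] simp del: One_nat_def)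
  subgoal for y A B using listed_9[of "y 6 + 3"]
    by (auto simp: power_add mult_ac One_nat_def[symmetric] simp del: One_nat_def)
  subgoal for y A B using listed_5[of "y 4 + 2"]
    by (auto simp: power_add mult_ac One_nat_def[symmetric] simp del: One_nat_def)
  subgoal for y A B using listed_9[of "y 6 + 4"]
    by (auto simp: power_add mult_ac One_nat_def[symmetric] simp del: One_nat_def)
  subgoal for y A B using listed_11[of "y 4 + 2" B]
    by (auto simp: power_add mult_ac One_nat_def[symmetric] simp del: One_nat_def)
  subgoal for y A B using represents_16[of "y 7 + 2" B]
    by (auto simp: power_add mult_ac One_nat_def[symmetric] simp del: One_nat_def)
  subgoal for y A B using listed_18[of "7 + 2 * y 7" B]
    by (auto simp: power_add mult_ac One_nat_def[symmetric] simp del: One_nat_def)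
  subgoal for y A B using listed_13[of "5 + 2 * y 2" B]
    by (auto simp: power_add mult_ac One_nat_def[symmetric] simp del: One_nat_def)
  subgoal for y A B using represents_6[of 0 "y 7" A B]
    by (auto simp: power_add ac_simps One_nat_def[symmetric] simp del: One_nat_def represents.simps)
  subgoal for y A B using represents_16[of "y 7 + 2" A]
    by (auto simp: power_add mult_ac One_nat_def[symmetric] simp del: One_nat_def)
  subgoal for y A B using represents_20[of "y 7" A B]
    by (auto simp: power_add mult_ac One_nat_def[symmetric] simp del: One_nat_def)
  subgoal for y A B using represents_16[of "y 7 + 2" B]
    by (auto simp: power_add mult_ac One_nat_def[symmetric] simp del: One_nat_def)
  subgoal for y A B using represents_20[of "y 7" B A]
    by (auto simp: power_add mult_ac One_nat_def[symmetric] simp del: One_nat_def)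
  subgoal for y A B using represents_6[of "y 2 + 1" "y 7" A B]
    by (auto simp: power_add ac_simps One_nat_def[symmetric] simp del: One_nat_def represents.simps)
  done

lemma entries_listed_diff_3: "list_all (entry_listed 3 0) (diff_table 3 0 [Plus 0, Half, Alt])"
  unfolding diff_table_3
  \<comment> \<open>The entries uniform in \<open>p\<close> are settled for every
    \<open>p >= 3\<close>; what remains is peculiar to 3.\<close>
  apply (simp add: entries_listed_large[unfolded diff_table_large list.pred_inject simp_thms]
    del: One_nat_def)
  apply (intro conjI entry_listedI;
    (auto simp: listed_22 listed_small_3 One_nat_def[symmetric] simp del: One_nat_def; fail)?)
  subgoal for y A B using listed_24[of "y 1"]
    by (auto simp: power_add mult_ac One_nat_def[symmetric] simp del: One_nat_def)
  subgoal for y A B using listed_24[of "y 1"]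
    by (auto simp: power_add mult_ac One_nat_def[symmetric] simp del: One_nat_def)
  subgoal for y A B using listed_29[of A "y 1"]
    by (auto simp: power_add mult_ac One_nat_def[symmetric] simp del: One_nat_def)
  subgoal for y A B using listed_27[of A "y 1"]
    by (auto simp: power_add mult_ac One_nat_def[symmetric] simp del: One_nat_def)
  subgoal for y A B using listed_33[of "3 + 2 * y 3" A]
    by (auto simp: power_add mult_ac One_nat_def[symmetric] simp del: One_nat_def)
  subgoal for y A B using listed_33[of "3 + 2 * y 3" A]
    by (auto simp: power_add mult_ac One_nat_def[symmetric] simp del: One_nat_def)
  subgoal for y A B using listed_31[of "3 + 2 * y 5" A]
    by (cases "A = B") (auto simp: One_nat_def[symmetric] simp del: One_nat_def)
  done

lemma entries_listed_sum_3: "list_all (entry_listed 3 0) (sum_table 3 [Plus 0, Half, Alt])"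
  unfolding sum_table_3
  apply (simp only: list.pred_inject simp_thms)
  apply (intro conjI entry_listedI;
    (auto simp: listed_22 listed_small_3 One_nat_def[symmetric] simp del: One_nat_def; fail)?)
  subgoal for y A B using listed_23[of "y 4 + 2"]
    by (auto simp: power_add mult_ac One_nat_def[symmetric] simp del: One_nat_def)
  subgoal for y A B using listed_23[of "y 2 + 2"]
    by (auto simp: power_add mult_ac One_nat_def[symmetric] simp del: One_nat_def)
  subgoal for y A B using listed_23[of "y 2 + 2"]
    by (auto simp: power_add mult_ac One_nat_def[symmetric] simp del: One_nat_def)
  subgoal for y A B using listed_28[of B "y 4 + 3"]
    by (auto simp: power_add mult_ac One_nat_def[symmetric] simp del: One_nat_def)
  subgoal for y A B using listed_25[of B "y 4 + 2"]
    by (auto simp: power_add mult_ac One_nat_def[symmetric] simp del: One_nat_def)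
  subgoal for y A B using listed_32[of "5 + 2 * y 7" B]
    by (auto simp: power_add mult_ac One_nat_def[symmetric] simp del: One_nat_def)
  subgoal for y A B using listed_26[of B "y 4 + 2"]
    by (auto simp: power_add mult_ac One_nat_def[symmetric] simp del: One_nat_def)
  subgoal for y A B using listed_26[of A "y 2 + 2"]
    by (auto simp: power_add mult_ac One_nat_def[symmetric] simp del: One_nat_def)
  subgoal for y A B using listed_32[of "5 + 2 * y 7" B]
    by (auto simp: power_add mult_ac One_nat_def[symmetric] simp del: One_nat_def)
  subgoal for y A B using listed_30[of "3 + 2 * y 7" A B]
    by (auto simp: power_add mult_ac One_nat_def[symmetric] simp del: One_nat_def)
  done

lemma entries_listed_diff_5: "list_all (entry_listed 5 0) (diff_table 5 0 [Plus 0, Half, Alt, Const 7])"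
  unfolding diff_table_5
  apply (simp add: entries_listed_large[unfolded diff_table_large list.pred_inject simp_thms]
    del: One_nat_def)
  apply (intro conjI entry_listedI;
    (auto simp: listed_34 listed_small_5 One_nat_def[symmetric] simp del: One_nat_def; fail)?)
  subgoal for y A B using listed_36[of A "y 1"]
    by (auto simp: power_add mult_ac One_nat_def[symmetric] simp del: One_nat_def)
  done

lemma entries_listed_sum_5: "list_all (entry_listed 5 0) (sum_table 5 [Plus 0, Half, Alt, Const 7])"
  unfolding sum_table_5
  apply (simp only: list.pred_inject simp_thms)
  apply (intro conjI entry_listedI;
    (auto simp: listed_34 listed_small_5 One_nat_def[symmetric] simp del: One_nat_def; fail)?)
  subgoal for y A B using listed_35[of B "y 4 + 2"]
    by (auto simp: power_add mult_ac One_nat_def[symmetric] simp del: One_nat_def)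
  done

lemma entries_listed_diff_7: "list_all (entry_listed 7 0) (diff_table 7 0 [Plus 0, Half, Alt])"
  unfolding diff_table_7
  apply (simp add: entries_listed_large[unfolded diff_table_large list.pred_inject simp_thms]
    del: One_nat_def)
  apply (intro conjI entry_listedI;
    (auto simp: listed_37 One_nat_def[symmetric] simp del: One_nat_def; fail)?)
  done

section \<open>The main theorem\<close>

text \<open>Form (ii) is absent for \<open>p = 2\<close>, so the value 1 needs a constant shape
  there; for odd \<open>p\<close> it is \<open>Half\<close> at exponent 0.\<close>

definition shapes :: "nat \<Rightarrow> shape list" where
  "shapes p = (if p = 2 then [Const 1, Plus 1, Alt] else if p = 5 then [Plus 0, Half, Alt, Const 7]
     else [Plus 0, Half, Alt])"

lemma FM_exponent_represents:
  assumes p: "prime p" and FM: "FM_exponent p d"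
  obtains k n s u w where "d = p ^ k * n" "\<not> p dvd n" "s \<in> set (shapes p)" "represents p s u w n"
proof -
  define k where "k = multiplicity p d"
  define n where "n = prime_to_part p d"
  have d0: "d > 0" using FM by (simp add: FM_exponent_def)
  have d: "d = p ^ k * n"
    using multiplicity_dvd[of p d] by (simp add: n_def k_def prime_to_part_def)
  have n: "\<not> p dvd n"
    using multiplicity_decompose[of d p] prime_gt_1_nat[OF p] d0 by (auto simp: n_def prime_to_part_def)
  have p2: "p \<ge> 2" using p by (rule prime_ge_2_nat)
  \<comment> \<open>Form (iii) with \<open>b = 1\<close> gives 1, which \<open>Alt\<close> misses
    because its multiplier starts at 3.\<close>
  have Alt1: "\<exists>s\<in>set (shapes p). \<exists>u w. represents p s u w n" if "n = 1"
  proof (cases "p = 2")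
    case True
    then have "Const 1 \<in> set (shapes p)" "represents p (Const 1) 0 0 n" using that by (simp_all add: shapes_def)
    then show ?thesis by blast
  next
    case False
    have "represents p Half 0 0 n" using that by simp
    moreover have "Half \<in> set (shapes p)" using False by (simp add: shapes_def)
    ultimately show ?thesis by blast
  qed
  have "(\<exists>a. n = p ^ a + 1 \<and> (p = 2 \<longrightarrow> a > 0)) \<or> (p > 2 \<and> (\<exists>a>0. n = (p ^ a + 1) div 2))
      \<or> (\<exists>a b. a > 0 \<and> b > 0 \<and> odd b \<and> n = (p ^ (a * b) + 1) div (p ^ a + 1)) \<or> (p = 5 \<and> n = 7)"
    using FM unfolding FM_exponent_def Let_def n_def by blast
  then have "\<exists>s\<in>set (shapes p). \<exists>u w. represents p s u w n"
  proof (elim disjE exE conjE)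
    fix a assume a: "n = p ^ a + 1" "p = 2 \<longrightarrow> a > 0"
    show ?thesis
    proof (cases "p = 2")
      case True
      then have "represents p (Plus 1) (a - 1) 0 n" using a by simp
      moreover have "Plus 1 \<in> set (shapes p)" using True by (simp add: shapes_def)
      ultimately show ?thesis by blast
    next
      case False
      have "represents p (Plus 0) a 0 n" using a by simp
      moreover have "Plus 0 \<in> set (shapes p)" using False by (simp add: shapes_def)
      ultimately show ?thesis by blast
    qed
  next
    fix a assume "p > 2" "n = (p ^ a + 1) div 2"
    moreover from this have "odd p" using p prime_odd_nat by blast
    ultimately have "represents p Half a 0 n" by simp
    moreover have "Half \<in> set (shapes p)" using \<open>p > 2\<close> by (simp add: shapes_def)
    ultimately show ?thesis by blast
  next
    fix a b assume ab: "a > 0" "b > 0" "odd b" "n = (p ^ (a * b) + 1) div (p ^ a + 1)"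
    show ?thesis
    proof (cases "b = 1")
      case True
      then show ?thesis using ab Alt1 by simp
    next
      case False
      then have "b = 3 + 2 * ((b - 3) div 2)" using ab(2,3) by presburger
      then obtain m where b: "b = 3 + 2 * m" by blast
      define u where "u = a - 1"
      have a: "a = Suc u" using ab by (simp add: u_def)
      \<comment> \<open>For odd \<open>b\<close>, \<open>x + 1\<close> divides
        \<open>x ^ b + 1\<close> because \<open>(-1) ^ b = -1\<close>; the detour through the
        integers provides the -1. So the \<open>div\<close> of form (iii) is exact.\<close>
      have "int p ^ a + 1 dvd (int p ^ a) ^ b + 1"
        using power_diff_sumr2[of "int p ^ a" b "-1"] ab(3) by simp
      then have "int (p ^ a + 1) dvd int (p ^ (a * b) + 1)" by (simp add: power_mult add.commute)
      then have "p ^ a + 1 dvd p ^ (a * b) + 1" by (simp only: of_nat_dvd_iff)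
      then have eq: "(p ^ a + 1) * n = p ^ (a * b) + 1"
        by (simp only: ab(4) dvd_mult_div_cancel)
      have exponent: "a * b = 3 + 3 * u + 2 * (Suc u * m)" by (simp add: a b algebra_simps)
      have "represents p Alt u (Suc u * m) n"
        using eq[unfolded exponent, unfolded a] unfolding represents.simps by (intro exI[of _ m] conjI refl)
      moreover have "Alt \<in> set (shapes p)" by (simp add: shapes_def)
      ultimately show ?thesis by blast
    qed
  next
    assume "p = 5" "n = 7"
    then have "Const 7 \<in> set (shapes p)" "represents p (Const 7) 0 0 n" by (simp_all add: shapes_def)
    then show ?thesis by blast
  qed
  then obtain s u w where "s \<in> set (shapes p)" "represents p s u w n" by blast
  then show thesis by (rule that[OF d n])
qed

lemma prime_cases:
  assumes "prime p"
  shows "p = 2 \<or> p = 3 \<or> p = 5 \<or> p = 7 \<or> p \<ge> (11::nat)"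
proof (rule ccontr)
  assume *: "\<not> ?thesis"
  have "odd p" using assms * prime_ge_2_nat[OF assms] prime_odd_nat[of p] by force
  then have "p = 9" using prime_ge_2_nat[OF assms] * by presburger
  then have "3 dvd p" by simp
  then have "(3 :: nat) = 1 \<or> 3 = p" using assms unfolding prime_nat_iff by blast
  then show False using \<open>p = 9\<close> by simp
qed

theorem mainTheorem12:
  fixes p A B :: nat
  assumes "prime p"
    and "A > 0" and "B > 0"
    and "coprime A p"
    and "FM_exponent p A" and "FM_exponent p B" and "FM_exponent p (A + B)"
  shows "listed_pair p A B \<or> listed_pair p B A"
proof -
  have p2: "p \<ge> 2" using assms(1) by (rule prime_ge_2_nat)
  define b where "b = (if p \<ge> 11 then 0 else int p)"
  define d where "d = (if p = 2 then 1 else 0 :: nat)"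
  have b: "base b (int p)" using p2 by (auto simp: base_def b_def)
  have tables: "list_all (entry_listed p d) (diff_table b d (shapes p)) \<and> list_all (entry_listed p 0) (sum_table b (shapes p))"
    using prime_cases[OF assms(1)]
  proof (elim disjE)
    assume "p \<ge> 11"
    then show ?thesis using entries_listed_large[of p] by (simp add: b_def d_def shapes_def sum_table_large)
  qed (auto simp: b_def d_def shapes_def sum_table_7 entries_listed_diff_2 entries_listed_sum_2 entries_listed_diff_3 entries_listed_sum_3
        entries_listed_diff_5 entries_listed_sum_5 entries_listed_diff_7 simp del: One_nat_def)
  have pA: "\<not> p dvd A"
    using assms(1,4) by (metis coprime_common_divisor dvd_refl not_prime_unit)
  obtain k1 n1 s1 u1 w1 where 1: "A = p ^ k1 * n1" "\<not> p dvd n1" "s1 \<in> set (shapes p)" "represents p s1 u1 w1 n1"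
    using FM_exponent_represents[OF assms(1,5)] by metis
  obtain k2 n2 s2 u2 w2 where 2: "B = p ^ k2 * n2" "\<not> p dvd n2" "s2 \<in> set (shapes p)" "represents p s2 u2 w2 n2"
    using FM_exponent_represents[OF assms(1,6)] by metis
  obtain k3 n3 s3 u3 w3 where 3: "A + B = p ^ k3 * n3" "\<not> p dvd n3" "s3 \<in> set (shapes p)" "represents p s3 u3 w3 n3"
    using FM_exponent_represents[OF assms(1,7)] by metis
  have A: "A = n1" using pA 1(1) by (cases k1) auto
  show ?thesis
  proof (cases k3)
    case 0
    \<comment> \<open>For \<open>p = 2\<close> both \<open>A\<close> and \<open>A + B\<close> are
      odd here, so \<open>B\<close> is even, which justifies the offset 1.\<close>
    have "k2 \<ge> d"
    proof (rule ccontr)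
      assume "\<not> k2 \<ge> d"
      then have "p = 2" "k2 = 0" by (auto simp: d_def split: if_splits)
      then show False using pA 2 3 0 by auto
    qed
    then obtain k where "k2 = d + k" using le_Suc_ex by blast
    then show ?thesis
      using diff_listed[OF conjunct1[OF tables] b 1(3) 2(3) 3(3) 1(4) 2(4) 3(4), of k] 2(1) 3(1) 0 A by simp
  next
    case (Suc k)
    have "k2 = 0"
    proof (rule ccontr)
      assume "k2 \<noteq> 0"
      then have "p dvd B" using 2(1) by (cases k2) auto
      moreover have "p dvd A + B" using 3(1) Suc by simp
      ultimately show False using pA by (simp add: dvd_add_left_iff)
    qed
    then show ?thesis
      using sum_listed[OF conjunct2[OF tables] b 1(3) 2(3) 3(3) 1(4) 2(4) 3(4), of k] 2(1) 3(1) Suc A by simp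
  qed
qed

end
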